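(* Let $X$ be a paracompact smooth Hausdorff manifold and let $u\in\mathcal G(X)$. The following are equivalent: (i) There exists $v\in\mathcal G(X)$ with $uv=1$ in $\mathcal G(X)$. (ii) For each representative $(u_\varepsilon)_\varepsilon$ of $u$ and each compact set $K\subset X$ there exist $\varepsilon_0>0$ and $q\in\mathbb N$ such that $\inf_{p\in K}|u_\varepsilon(p)|\ge\varepsilon^q$ for all $\varepsilon<\varepsilon_0$.
   Context: Let $\mathbb K=\mathbb R$ or $\mathbb C$ and let functions on $X$ be $\mathbb K$-valued. The (special) Colombeau algebra is $\mathcal G(X):=\mathcal E_M(X)/\mathcal N(X)$, where: $\mathcal E_M(X)$ is the set of nets $(u_\varepsilon)_{\varepsilon\in(0,1]}$ in $C^\infty(X)$ such that for every compact $K\subset X$ and every linear differential operator $P$ on $C^\infty(X)$ there is $N\in\mathbb N$ with $\sup_{p\in K}|Pu_\varepsilon(p)|=O(\varepsilon^{-N})$ as $\varepsilon\to0$; $\mathcal N(X)$ is the set of $(u_\varepsilon)_\varepsilon\in\mathcal E_M(X)$ such that for every compact $K\subset X$ and every $m\in\mathbb N_0$, $\sup_{p\in K}|u_\varepsilon(p)|=O(\varepsilon^m)$ as $\varepsilon\to0$. Operations are defined $\varepsilon$-wise on representatives, and $1$ denotes the class of the constant net $1$. *)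

theory Defs
  imports
    "HOL-Analysis.Analysis"
    "HOL-Library.Landau_Symbols"
    "HOL-Algebra.QuotRing"
begin

section \<open>Smooth functions on open subsets of the model space\<close>

definition dir_deriv ::
    "'e::real_normed_vector \<Rightarrow> ('e \<Rightarrow> 'b::real_normed_vector) \<Rightarrow> 'e \<Rightarrow> 'b" where
  "dir_deriv v f x = frechet_derivative f (at x) v"

fun iter_dir_deriv ::
    "'e::real_normed_vector list \<Rightarrow> ('e \<Rightarrow> 'b::real_normed_vector) \<Rightarrow> 'e \<Rightarrow> 'b" where
  "iter_dir_deriv [] f = f"
| "iter_dir_deriv (v # vs) f = dir_deriv v (iter_dir_deriv vs f)"

text \<open>Only meant for open \<open>S\<close> in a finite-dimensional space, where continuity of the Frechet
  derivative is the same as continuity of all directional derivatives.\<close>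

fun Ck_on :: "nat \<Rightarrow> 'e::real_normed_vector set \<Rightarrow> ('e \<Rightarrow> 'b::real_normed_vector) \<Rightarrow> bool" where
  "Ck_on 0 S f \<longleftrightarrow> continuous_on S f"
| "Ck_on (Suc k) S f \<longleftrightarrow>
     (\<forall>x\<in>S. f differentiable (at x)) \<and> (\<forall>v. Ck_on k S (dir_deriv v f))"

definition smooth_on :: "'e::real_normed_vector set \<Rightarrow> ('e \<Rightarrow> 'b::real_normed_vector) \<Rightarrow> bool" where
  "smooth_on S f \<longleftrightarrow> (\<forall>k. Ck_on k S f)"


section \<open>Smooth manifolds\<close>

text \<open>The underlying set of the manifold is the whole type \<open>'a\<close>. A chart \<open>(U, \<phi>)\<close> is only
  relevant on \<open>U\<close>; its inverse is \<open>inv_into U \<phi>\<close>.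

  The model space is an arbitrary finite-dimensional real inner product space. The class
  \<open>euclidean_space\<close> is not used because it excludes the zero space, that is, manifolds of
  dimension 0.\<close>

type_synonym ('a, 'e) chart = "'a set \<times> ('a \<Rightarrow> 'e)"

definition is_chart :: "('a::topological_space, 'e::real_inner) chart \<Rightarrow> bool" where
  "is_chart c \<longleftrightarrow> (case c of (U, \<phi>) \<Rightarrow>
     open U \<and> open (\<phi> ` U) \<and> homeomorphism U (\<phi> ` U) \<phi> (inv_into U \<phi>))"

definition smooth_atlas :: "('a::topological_space, 'e::real_inner) chart set \<Rightarrow> bool" where
  "smooth_atlas A \<longleftrightarrow>
     (\<exists>B::'e set. finite B \<and> span B = UNIV) \<and>
     (\<forall>c\<in>A. is_chart c) \<and>
     (\<Union>(U, \<phi>)\<in>A. U) = UNIV \<and>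
     (\<forall>(U, \<phi>)\<in>A. \<forall>(V, \<psi>)\<in>A. smooth_on (\<phi> ` (U \<inter> V)) (\<psi> \<circ> inv_into U \<phi>))"

definition paracompact_space :: "'a topology \<Rightarrow> bool" where
  "paracompact_space X \<longleftrightarrow>
     (\<forall>\<U>. (\<forall>U\<in>\<U>. openin X U) \<and> \<Union>\<U> = topspace X \<longrightarrow>
        (\<exists>\<V>. (\<forall>V\<in>\<V>. openin X V) \<and> \<Union>\<V> = topspace X \<and>
             (\<forall>V\<in>\<V>. \<exists>U\<in>\<U>. V \<subseteq> U) \<and> locally_finite_in X \<V>))"

definition smooth_functions ::
    "('a::topological_space, 'e::real_inner) chart set \<Rightarrow> ('a \<Rightarrow> 'k::real_normed_field) set" where
  "smooth_functions A = {f. \<forall>(U, \<phi>)\<in>A. smooth_on (\<phi> ` U) (f \<circ> inv_into U \<phi>)}"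

text \<open>Linear differential operators on the smooth functions: in every chart, \<open>P\<close> is a finite sum
  of iterated partial derivatives of order at most \<open>k\<close> with smooth coefficients. The list
  \<open>[v\<^sub>1, \<dots>, v\<^sub>r]\<close> stands for the derivative in the directions \<open>v\<^sub>1, \<dots>, v\<^sub>r\<close>; expanding the directions in
  a basis gives the usual multi-index form. That \<open>P\<close> is linear on smooth functions and maps them
  to smooth functions follows from the local form. The values of \<open>P\<close> on non-smooth functions
  are irrelevant.\<close>

definition linear_diff_op ::
    "('a::topological_space, 'e::real_inner) chart set \<Rightarrow>
     (('a \<Rightarrow> 'k::real_normed_field) \<Rightarrow> ('a \<Rightarrow> 'k)) \<Rightarrow> bool" where
  "linear_diff_op A P \<longleftrightarrow>
     (\<exists>k::nat. \<forall>(U, \<phi>)\<in>A. \<exists>(L::'e list set) (a::'e list \<Rightarrow> 'e \<Rightarrow> 'k).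
        finite L \<and> (\<forall>vs\<in>L. length vs \<le> k \<and> smooth_on (\<phi> ` U) (a vs)) \<and>
        (\<forall>f\<in>smooth_functions A. \<forall>p\<in>U.
           P f p = (\<Sum>vs\<in>L. a vs (\<phi> p) * iter_dir_deriv vs (f \<circ> inv_into U \<phi>) (\<phi> p))))"


section \<open>The special Colombeau algebra\<close>

text \<open>The supremum of \<open>|f|\<close> over \<open>K\<close> in \<open>[0, \<infinity>)\<close>. Inserting \<open>0\<close> only matters for \<open>K = {}\<close>.\<close>

definition sup_on :: "'a set \<Rightarrow> ('a \<Rightarrow> 'k::real_normed_field) \<Rightarrow> real" where
  "sup_on K f = Sup (insert 0 ((\<lambda>p. norm (f p)) ` K))"

type_synonym ('a, 'k) net = "real \<Rightarrow> 'a \<Rightarrow> 'k"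

definition moderate ::
    "('a::topological_space, 'e::real_inner) chart set \<Rightarrow> ('a, 'k::real_normed_field) net set" where
  "moderate A = {u \<in> {0<..1} \<rightarrow>\<^sub>E smooth_functions A.
     \<forall>K P. compact K \<longrightarrow> linear_diff_op A P \<longrightarrow>
       (\<exists>N::nat. (\<lambda>\<epsilon>. sup_on K (P (u \<epsilon>))) \<in> O[at_right 0](\<lambda>\<epsilon>. 1 / \<epsilon> ^ N))}"

definition negligible_nets ::
    "('a::topological_space, 'e::real_inner) chart set \<Rightarrow> ('a, 'k::real_normed_field) net set" where
  "negligible_nets A = {u \<in> moderate A.
     \<forall>K (m::nat). compact K \<longrightarrow> (\<lambda>\<epsilon>. sup_on K (u \<epsilon>)) \<in> O[at_right 0](\<lambda>\<epsilon>. \<epsilon> ^ m)}"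

definition moderate_ring ::
    "('a::topological_space, 'e::real_inner) chart set \<Rightarrow> ('a, 'k::real_normed_field) net ring" where
  "moderate_ring A =
     \<lparr>carrier = moderate A,
      mult = (\<lambda>u v. \<lambda>\<epsilon>\<in>{0<..1}. \<lambda>p. u \<epsilon> p * v \<epsilon> p),
      one = (\<lambda>\<epsilon>\<in>{0<..1}. \<lambda>p. 1),
      zero = (\<lambda>\<epsilon>\<in>{0<..1}. \<lambda>p. 0),
      add = (\<lambda>u v. \<lambda>\<epsilon>\<in>{0<..1}. \<lambda>p. u \<epsilon> p + v \<epsilon> p)\<rparr>"

text \<open>Elements are cosets; the representatives of \<open>u\<close> are the elements of the set \<open>u\<close>.\<close>

definition colombeau ::
    "('a::topological_space, 'e::real_inner) chart set \<Rightarrow>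
     ('a, 'k::real_normed_field) net set ring" where
  "colombeau A = moderate_ring A Quot negligible_nets A"

end

theory Submission
  imports Defs
begin

text \<open>
  Let \<open>w\<close> represent \<open>u\<close>. If \<open>u\<close> has an inverse, represented by \<open>z\<close>, then \<open>w z = 1 + n\<close> with \<open>n\<close>
  negligible. On a compact set \<open>n\<close> is eventually small and \<open>z\<close> is at most a power of \<open>1 / \<epsilon>\<close>, so \<open>w\<close> is
  at least a power of \<open>\<epsilon>\<close> (lemma \<open>unit_imp_bounded_below_net\<close>).

  Conversely, the pointwise inverse of \<open>w\<close> need not exist: for a given \<open>\<epsilon>\<close> the lower bound is only known
  on those compact sets whose \<open>\<epsilon>\<^sub>0\<close> exceeds \<open>\<epsilon>\<close>, and \<open>w\<close> may vanish elsewhere. The net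
  \<open>v = cj w / (|w|\<^sup>2 + exp (- 1 / \<epsilon>))\<close>, where \<open>cj\<close> is conjugation, avoids this. Its denominator is
  positive everywhere, so \<open>v\<close> is smooth on the whole manifold. On a compact set with
  \<open>|w| \<ge> \<epsilon> ^ q\<close> the denominator is at least \<open>\<epsilon> ^ (2 q)\<close>, and
  \<open>w v - 1 = - exp (- 1 / \<epsilon>) / (|w|\<^sup>2 + exp (- 1 / \<epsilon>))\<close> decreases faster than every power of \<open>\<epsilon>\<close> (lemma
  \<open>bounded_below_net_imp_unit\<close>).

  What remains is that \<open>v\<close> and products of moderate nets are moderate. A derivative of an inverse or a
  product is a polynomial in the derivatives of the factors and the inverse itself, but the definition
  of moderateness quantifies over global differential operators. Proposition
  \<open>moderate_iff_smooth_tempered\<close> translates it into bounds on all iterated derivatives in all charts. One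
  direction writes an operator in charts. The other extends a chart derivative, near a given point, to a
  global operator; the extension is a composition of vector fields, each cut off by a smooth function
  with compact support in the chart, so that only the chain rule for first derivatives is needed to
  change charts. The cut-off functions are built from \<open>exp (- 1 / t)\<close>.
\<close>

section \<open>Smooth maps between finite-dimensional inner product spaces\<close>

text \<open>A coordinate expansion that works for every finite-dimensional inner product space. The class
  \<open>euclidean_space\<close> excludes the zero space, for which the empty set is a frame.\<close>

definition parseval_frame :: "'e::real_inner set \<Rightarrow> bool" where
  "parseval_frame E \<longleftrightarrow> finite E \<and> (\<forall>x. (\<Sum>b\<in>E. (x \<bullet> b) *\<^sub>R b) = x)"

text \<open>Normalize an orthogonal generating set. The expansion fixes its elements, hence all of their span.\<close>

lemma parseval_frame_exists:
  fixes B :: "'e::real_inner set"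
  assumes "finite B" "span B = UNIV"
  obtains E :: "'e set" where "parseval_frame E"
proof -
  obtain C where C: "finite C" "span C = (UNIV::'e set)" "pairwise orthogonal C"
    using basis_orthogonal[OF assms(1)] assms(2) by metis
  define E where "E = sgn ` (C - {0})"
  have fin: "finite E" using C(1) by (simp add: E_def)
  have ort: "b \<bullet> b' = (if b = b' then 1 else 0)" if bE: "b \<in> E" "b' \<in> E" for b b'
  proof -
    obtain c c' where c: "c \<in> C" "c \<noteq> 0" "b = sgn c" "c' \<in> C" "c' \<noteq> 0" "b' = sgn c'"
      using bE unfolding E_def by blast
    show ?thesis
    proof (cases "c = c'")
      case True
      then have "b \<bullet> b' = norm b ^ 2"
        using c by (simp add: dot_square_norm)
      then show ?thesis using True c by (simp add: norm_sgn)
    next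
      case False
      then have "c \<bullet> c' = 0" using C(3) c by (auto simp: pairwise_def orthogonal_def)
      then have *: "b \<bullet> b' = 0" using c by (simp add: sgn_div_norm)
      moreover have "b \<noteq> b'" 
        using * c by (metis inner_eq_zero_iff sgn_zero_iff)
      ultimately show ?thesis by simp
    qed
  qed
  have lin: "linear (\<lambda>x. \<Sum>b\<in>E. (x \<bullet> b) *\<^sub>R b)"
    by (intro linearI) (auto simp: inner_add_left scaleR_add_left sum.distrib scaleR_sum_right)
  have "span E = UNIV"
  proof -
    have "c \<in> span E" if "c \<in> C" for c
    proof (cases "c = 0")
      case False
      then have "sgn c \<in> span E" using that by (intro span_base) (auto simp: E_def)
      then have "norm c *\<^sub>R sgn c \<in> span E" by (rule span_scale)
      then show ?thesis using False by (simp add: sgn_div_norm)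
    qed (simp add: span_zero)
    then have "span C \<subseteq> span E" by (intro span_minimal) (auto simp: subspace_span)
    then show ?thesis using C by auto
  qed
  moreover have "(\<Sum>b\<in>E. (x \<bullet> b) *\<^sub>R b) = x" if "x \<in> E" for x
  proof -
    have "(\<Sum>b\<in>E. (x \<bullet> b) *\<^sub>R b) = (\<Sum>b\<in>E. if x = b then b else 0)"
      using ort[OF that] by (intro sum.cong) auto
    then show ?thesis using fin that by (simp add: sum.delta')
  qed
  ultimately have "(\<Sum>b\<in>E. (x \<bullet> b) *\<^sub>R b) = x" for x
    using linear_eq_on_span[OF lin linear_id, of E x] by (auto simp: id_def)
  then show thesis using that fin by (auto simp: parseval_frame_def)
qed

lemma parseval_frame_real: "parseval_frame {1::real}"
  by (simp add: parseval_frame_def)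

lemma linear_frame_expansion:
  assumes "parseval_frame E" "linear D"
  shows "D x = (\<Sum>b\<in>E. (x \<bullet> b) *\<^sub>R D b)"
proof -
  have "D x = D (\<Sum>b\<in>E. (x \<bullet> b) *\<^sub>R b)" using assms by (simp add: parseval_frame_def)
  also have "\<dots> = (\<Sum>b\<in>E. (x \<bullet> b) *\<^sub>R D b)"
    using assms(2) by (simp add: linear_sum linear_scale)
  finally show ?thesis .
qed

text \<open>The coordinates of a ball lie in a cube, and the cube is a finite sum of compact segments.\<close>

lemma compact_cball_frame:
  fixes E :: "'e::real_inner set"
  assumes E: "parseval_frame E"
  shows "compact (cball (x::'e) r)"
proof -
  obtain M where M: "\<And>b. b \<in> E \<Longrightarrow> norm b \<le> M" "0 \<le> M"
    using finite_imp_bounded[of E] E unfolding parseval_frame_def bounded_pos by fastforce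
  define R where "R = (norm x + \<bar>r\<bar>) * M"
  define box where "box F = {\<Sum>b\<in>F. t b *\<^sub>R b | t. \<forall>b\<in>F. \<bar>t b\<bar> \<le> R}" for F :: "'e set"
  have "compact (box F)" if "finite F" for F
    using that
  proof (induction F)
    case empty
    then show ?case by (simp add: box_def)
  next
    case (insert a F)
    have "box (insert a F) = {y + z | y z. y \<in> (\<lambda>t. t *\<^sub>R a) ` {-R..R} \<and> z \<in> box F}" (is "_ = ?S")
    proof (intro subset_antisym subsetI)
      fix y assume "y \<in> box (insert a F)"
      then obtain t where t: "\<forall>b\<in>insert a F. \<bar>t b\<bar> \<le> R" "y = (\<Sum>b\<in>insert a F. t b *\<^sub>R b)"
        by (auto simp: box_def)
      then have "y = t a *\<^sub>R a + (\<Sum>b\<in>F. t b *\<^sub>R b)" using insert by simp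
      moreover have "t a *\<^sub>R a \<in> (\<lambda>t. t *\<^sub>R a) ` {-R..R}" using t by (auto simp: abs_le_iff)
      moreover have "(\<Sum>b\<in>F. t b *\<^sub>R b) \<in> box F" using t by (auto simp: box_def)
      ultimately show "y \<in> ?S" by blast
    next
      fix y assume "y \<in> ?S"
      then obtain s t where *: "s \<in> {-R..R}" "\<forall>b\<in>F. \<bar>t b\<bar> \<le> R" "y = s *\<^sub>R a + (\<Sum>b\<in>F. t b *\<^sub>R b)"
        unfolding box_def by blast
      have "(\<Sum>b\<in>F. t b *\<^sub>R b) = (\<Sum>b\<in>F. (t(a := s)) b *\<^sub>R b)"
        using insert by (intro sum.cong) auto
      then show "y \<in> box (insert a F)"
        using * insert unfolding box_def by (intro CollectI exI[of _ "t(a := s)"]) auto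
    qed
    moreover have "compact ((\<lambda>t. t *\<^sub>R a) ` {-R..R})"
      by (intro compact_continuous_image continuous_intros) auto
    ultimately show ?case using compact_sums insert by auto
  qed
  then have "compact (box E)" using E by (simp add: parseval_frame_def)
  moreover have "cball x r \<subseteq> box E"
  proof
    fix y assume "y \<in> cball x r"
    then have ny: "norm y \<le> norm x + \<bar>r\<bar>"
      using norm_triangle_ineq[of x "y - x"] by (simp add: dist_norm norm_minus_commute)
    have "\<bar>y \<bullet> b\<bar> \<le> R" if "b \<in> E" for b
      using Cauchy_Schwarz_ineq2[of y b] M(1)[OF that] ny M(2)
      unfolding R_def by (meson abs_ge_zero add_nonneg_nonneg mult_mono norm_ge_zero order_trans)
    moreover have "y = (\<Sum>b\<in>E. (y \<bullet> b) *\<^sub>R b)" using E by (simp add: parseval_frame_def)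
    ultimately show "y \<in> box E"
      unfolding box_def by blast
  qed
  ultimately show ?thesis
    using closed_Int_compact[OF closed_cball[of x r], of "box E"] by (simp add: Int_absorb2)
qed

subsection \<open>Directional derivatives\<close>

lemma dir_deriv_eq:
  "(f has_derivative D) (at x) \<Longrightarrow> dir_deriv v f x = D v"
  unfolding dir_deriv_def using frechet_derivative_at by metis

lemma has_derivative_dir_deriv:
  "f differentiable (at x) \<Longrightarrow> (f has_derivative (\<lambda>v. dir_deriv v f x)) (at x)"
  unfolding dir_deriv_def by (simp add: frechet_derivative_works[symmetric])

lemma has_derivative_cong_open:
  assumes "open S" "x \<in> S" "\<And>y. y \<in> S \<Longrightarrow> f y = g y"
  shows "(f has_derivative D) (at x) \<longleftrightarrow> (g has_derivative D) (at x)"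
  using assms has_derivative_transform_within_open[of f D x UNIV S g]
    has_derivative_transform_within_open[of g D x UNIV S f] by auto

lemma dir_deriv_cong_open:
  assumes "open S" "x \<in> S" "\<And>y. y \<in> S \<Longrightarrow> f y = g y"
  shows "dir_deriv v f x = dir_deriv v g x"
  unfolding dir_deriv_def frechet_derivative_def using has_derivative_cong_open[OF assms] by simp

lemma iter_dir_deriv_snoc:
  "iter_dir_deriv (vs @ [v]) f = iter_dir_deriv vs (dir_deriv v f)"
  by (induction vs) auto

lemma Ck_on_cong:
  assumes "open S" "\<And>y. y \<in> S \<Longrightarrow> f y = g y"
  shows "Ck_on k S f \<longleftrightarrow> Ck_on k S g"
  using assms(2)
proof (induction k arbitrary: f g)
  case 0
  then show ?case by (simp cong: continuous_on_cong)
next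
  case (Suc k)
  have "f differentiable (at x) \<longleftrightarrow> g differentiable (at x)" if "x \<in> S" for x
    using has_derivative_cong_open[OF assms(1) that] Suc.prems unfolding differentiable_def by blast
  moreover have "Ck_on k S (dir_deriv v f) \<longleftrightarrow> Ck_on k S (dir_deriv v g)" for v
    by (intro Suc.IH dir_deriv_cong_open[OF assms(1)] Suc.prems)
  ultimately show ?case by simp
qed

lemma Ck_on_subset: "Ck_on k S f \<Longrightarrow> T \<subseteq> S \<Longrightarrow> Ck_on k T f"
  by (induction k arbitrary: f) (auto intro: continuous_on_subset)

lemma Ck_on_SucD: "Ck_on (Suc k) S f \<Longrightarrow> Ck_on k S f"
proof (induction k arbitrary: f)
  case 0
  then show ?case
    by (auto intro!: continuous_at_imp_continuous_on differentiable_imp_continuous_within)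
qed auto

text \<open>Coefficients that are extended by zero across the boundary of a chart domain are smooth on each of
  two overlapping open sets; this lemma glues them.\<close>

lemma Ck_on_local:
  assumes "\<And>x. x \<in> S \<Longrightarrow> \<exists>T. open T \<and> x \<in> T \<and> Ck_on k T f"
  shows "Ck_on k S f"
  using assms
proof (induction k arbitrary: f)
  case 0
  have "isCont f x" if "x \<in> S" for x
    using 0[OF that] by (auto simp: continuous_on_eq_continuous_at)
  then show ?case by (simp add: continuous_at_imp_continuous_on)
next
  case (Suc k)
  have "f differentiable (at x)" if "x \<in> S" for x using Suc.prems[OF that] by auto
  moreover have "Ck_on k S (dir_deriv v f)" for v
    using Suc.prems by (intro Suc.IH) (metis Ck_on.simps(2))
  ultimately show ?case by simp
qed

lemma Ck_on_const: "Ck_on k S (\<lambda>x. c)"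
proof (induction k arbitrary: c)
  case (Suc k)
  have "dir_deriv v (\<lambda>x. c) = (\<lambda>x. 0)" for v :: 'a
    by (rule ext, subst dir_deriv_eq[OF has_derivative_const]) simp
  then show ?case using Suc by simp
qed simp

lemma Ck_on_bounded_linear:
  assumes "bounded_linear f"
  shows "Ck_on k S f"
proof (cases k)
  case 0
  then show ?thesis using assms by (simp add: linear_continuous_on)
next
  case (Suc j)
  have der: "(f has_derivative f) (at x)" for x
    using assms by (rule bounded_linear_imp_has_derivative)
  have "dir_deriv v f = (\<lambda>x. f v)" for v
    using dir_deriv_eq[OF der] by auto
  moreover have "f differentiable (at x)" for x
    using der unfolding differentiable_def by blast
  ultimately show ?thesis using Suc by (simp add: Ck_on_const)
qed

lemma dir_deriv_add:
  assumes "f differentiable (at x)" "g differentiable (at x)"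
  shows "dir_deriv v (\<lambda>x. f x + g x) x = dir_deriv v f x + dir_deriv v g x"
  using dir_deriv_eq[OF has_derivative_add[OF has_derivative_dir_deriv[OF assms(1)]
      has_derivative_dir_deriv[OF assms(2)]]] .

lemma (in bounded_bilinear) dir_deriv_bilinear:
  assumes "f differentiable (at x)" "g differentiable (at x)"
  shows "dir_deriv v (\<lambda>x. prod (f x) (g x)) x
    = prod (f x) (dir_deriv v g x) + prod (dir_deriv v f x) (g x)"
  using dir_deriv_eq[OF FDERIV[OF has_derivative_dir_deriv[OF assms(1)]
      has_derivative_dir_deriv[OF assms(2)]]] .

lemma Ck_on_add:
  assumes "open S" "Ck_on k S f" "Ck_on k S g"
  shows "Ck_on k S (\<lambda>x. f x + g x)"
  using assms(2,3)
proof (induction k arbitrary: f g)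
  case 0
  then show ?case by (auto intro: continuous_intros)
next
  case (Suc k)
  have "Ck_on k S (dir_deriv v (\<lambda>x. f x + g x))" for v
  proof (subst Ck_on_cong[OF assms(1)])
    show "dir_deriv v (\<lambda>x. f x + g x) y = dir_deriv v f y + dir_deriv v g y" if "y \<in> S" for y
      using that Suc.prems by (intro dir_deriv_add) auto
    show "Ck_on k S (\<lambda>y. dir_deriv v f y + dir_deriv v g y)"
      using Suc by auto
  qed
  then show ?case using Suc.prems by auto
qed

lemma Ck_on_sum:
  assumes "open S" "\<And>i. i \<in> I \<Longrightarrow> Ck_on k S (f i)"
  shows "Ck_on k S (\<lambda>x. \<Sum>i\<in>I. f i x)"
  using assms(2)
proof (induction I rule: infinite_finite_induct)
  case (insert i I)
  then show ?case using Ck_on_add[OF assms(1), of k "f i"] by simp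
qed (auto intro: Ck_on_const)

lemma (in bounded_bilinear) Ck_on_bilinear:
  assumes "open S" "Ck_on k S f" "Ck_on k S g"
  shows "Ck_on k S (\<lambda>x. prod (f x) (g x))"
  using assms(2,3)
proof (induction k arbitrary: f g)
  case 0
  then show ?case by (auto intro: continuous_on)
next
  case (Suc k)
  have "Ck_on k S (dir_deriv v (\<lambda>x. prod (f x) (g x)))" for v
  proof (subst Ck_on_cong[OF assms(1)])
    show "dir_deriv v (\<lambda>x. prod (f x) (g x)) y
        = prod (f y) (dir_deriv v g y) + prod (dir_deriv v f y) (g y)" if "y \<in> S" for y
      using that Suc.prems by (intro dir_deriv_bilinear) auto
    show "Ck_on k S (\<lambda>y. prod (f y) (dir_deriv v g y) + prod (dir_deriv v f y) (g y))"
      using Suc by (intro Ck_on_add[OF assms(1)] Suc.IH Ck_on_SucD[of k S f] Ck_on_SucD[of k S g]) auto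
  qed
  moreover have "(\<lambda>x. prod (f x) (g x)) differentiable (at x)" if "x \<in> S" for x
    using Suc.prems that FDERIV unfolding Ck_on.simps differentiable_def by blast
  ultimately show ?case by auto
qed

text \<open>Expanding the inner derivative in a frame turns the chain rule into a finite sum of products, to
  which the product and sum rules apply again. This is what makes the induction on the order in
  the next lemma work.\<close>

lemma dir_deriv_compose:
  assumes E: "parseval_frame E"
    and "f differentiable (at (g x))" "g differentiable (at x)"
  shows "dir_deriv v (f \<circ> g) x = (\<Sum>b\<in>E. (dir_deriv v g x \<bullet> b) *\<^sub>R dir_deriv b f (g x))"
proof -
  have f: "(f has_derivative (\<lambda>w. dir_deriv w f (g x))) (at (g x))"
    using assms by (intro has_derivative_dir_deriv)
  have "dir_deriv v (f \<circ> g) x = dir_deriv (dir_deriv v g x) f (g x)"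
    using dir_deriv_eq[OF diff_chain_at[OF has_derivative_dir_deriv[OF assms(3)] f]] by simp
  also have "\<dots> = (\<Sum>b\<in>E. (dir_deriv v g x \<bullet> b) *\<^sub>R dir_deriv b f (g x))"
    by (rule linear_frame_expansion[OF E has_derivative_linear[OF f]])
  finally show ?thesis .
qed

lemma Ck_on_compose:
  assumes E: "parseval_frame (E :: 'f::real_inner set)" and S: "open S" "g ` S \<subseteq> T"
    and "Ck_on k T f" "Ck_on k S (g :: 'e::real_normed_vector \<Rightarrow> 'f)"
  shows "Ck_on k S (f \<circ> g)"
  using assms(4,5)
proof (induction k arbitrary: f)
  case 0
  then show ?case
    using S(2) by (auto intro: continuous_on_compose continuous_on_subset simp del: o_apply)
next
  case (Suc k)
  have "Ck_on k S (dir_deriv v (f \<circ> g))" for v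
  proof (subst Ck_on_cong[OF S(1)])
    show "dir_deriv v (f \<circ> g) y = (\<Sum>b\<in>E. (dir_deriv v g y \<bullet> b) *\<^sub>R (dir_deriv b f \<circ> g) y)"
      if "y \<in> S" for y
      using that Suc.prems S(2) by (subst dir_deriv_compose[OF E]) auto
    show "Ck_on k S (\<lambda>y. \<Sum>b\<in>E. (dir_deriv v g y \<bullet> b) *\<^sub>R (dir_deriv b f \<circ> g) y)"
      using Suc by (intro Ck_on_sum S(1) bounded_bilinear.Ck_on_bilinear[OF bounded_bilinear_scaleR]
          bounded_bilinear.Ck_on_bilinear[OF bounded_bilinear_inner] Ck_on_const Suc.IH
          Ck_on_SucD[of k S g]) auto
  qed
  moreover have "(f \<circ> g) differentiable (at x)" if "x \<in> S" for x
    using Suc.prems that S(2) by (intro differentiable_chain_at) auto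
  ultimately show ?case by (simp del: o_apply add: Ck_on.simps)
qed

lemma dir_deriv_inverse:
  fixes f :: "'e::real_normed_vector \<Rightarrow> 'k::real_normed_field"
  assumes "f differentiable (at x)" "f x \<noteq> 0"
  shows "dir_deriv v (\<lambda>x. inverse (f x)) x = - (dir_deriv v f x * (inverse (f x) * inverse (f x)))"
  using dir_deriv_eq[OF Deriv.has_derivative_inverse[OF assms(2) has_derivative_dir_deriv[OF assms(1)]], of v]
  by (simp add: ac_simps)

lemma Ck_on_inverse:
  fixes f :: "'e::real_normed_vector \<Rightarrow> 'k::real_normed_field"
  assumes "open S" "Ck_on k S f" "\<And>x. x \<in> S \<Longrightarrow> f x \<noteq> 0"
  shows "Ck_on k S (\<lambda>x. inverse (f x))"
  using assms(2)
proof (induction k)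
  case 0
  then show ?case using assms(3) by (auto intro: continuous_on_inverse)
next
  case (Suc k)
  note mult = bounded_bilinear.Ck_on_bilinear[OF bounded_bilinear_mult assms(1)]
  have inv: "Ck_on k S (\<lambda>x. inverse (f x))" using Suc Ck_on_SucD by blast
  have "Ck_on k S (dir_deriv v (\<lambda>x. inverse (f x)))" for v
  proof (subst Ck_on_cong[OF assms(1)])
    show "dir_deriv v (\<lambda>x. inverse (f x)) y
        = (- 1) * (dir_deriv v f y * (inverse (f y) * inverse (f y)))" if "y \<in> S" for y
      using that Suc.prems assms(3) by (subst dir_deriv_inverse) auto
    show "Ck_on k S (\<lambda>y. (- 1) * (dir_deriv v f y * (inverse (f y) * inverse (f y))))"
      using Suc.prems inv by (intro mult Ck_on_const) auto
  qed
  moreover have "(\<lambda>x. inverse (f x)) differentiable (at x)" if "x \<in> S" for x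
    using Suc.prems that assms(3) by (auto intro!: differentiable_inverse)
  ultimately show ?case by auto
qed

subsection \<open>Smooth functions\<close>

lemma smooth_on_cong:
  "open S \<Longrightarrow> (\<And>y. y \<in> S \<Longrightarrow> f y = g y) \<Longrightarrow> smooth_on S f \<longleftrightarrow> smooth_on S g"
  unfolding smooth_on_def using Ck_on_cong by blast

lemma smooth_on_subset: "smooth_on S f \<Longrightarrow> T \<subseteq> S \<Longrightarrow> smooth_on T f"
  unfolding smooth_on_def using Ck_on_subset by blast

lemma smooth_on_local:
  "(\<And>x. x \<in> S \<Longrightarrow> \<exists>T. open T \<and> x \<in> T \<and> smooth_on T f) \<Longrightarrow> smooth_on S f"
  unfolding smooth_on_def by (metis Ck_on_local)

lemma smooth_on_const: "smooth_on S (\<lambda>x. c)"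
  by (simp add: smooth_on_def Ck_on_const)

lemma smooth_on_bounded_linear: "bounded_linear f \<Longrightarrow> smooth_on S f"
  by (simp add: smooth_on_def Ck_on_bounded_linear)

lemma smooth_on_add:
  "open S \<Longrightarrow> smooth_on S f \<Longrightarrow> smooth_on S g \<Longrightarrow> smooth_on S (\<lambda>x. f x + g x)"
  by (simp add: smooth_on_def Ck_on_add)

lemma smooth_on_sum:
  "open S \<Longrightarrow> (\<And>i. i \<in> I \<Longrightarrow> smooth_on S (f i)) \<Longrightarrow> smooth_on S (\<lambda>x. \<Sum>i\<in>I. f i x)"
  unfolding smooth_on_def by (blast intro: Ck_on_sum)

lemma (in bounded_bilinear) smooth_on_bilinear:
  "open S \<Longrightarrow> smooth_on S f \<Longrightarrow> smooth_on S g \<Longrightarrow> smooth_on S (\<lambda>x. prod (f x) (g x))"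
  by (simp add: smooth_on_def Ck_on_bilinear)

lemmas smooth_on_mult = bounded_bilinear.smooth_on_bilinear[OF bounded_bilinear_mult]
lemmas smooth_on_inner = bounded_bilinear.smooth_on_bilinear[OF bounded_bilinear_inner]

lemma smooth_on_compose:
  assumes "parseval_frame (E :: 'f::real_inner set)" "open S" "g ` S \<subseteq> T"
    and "smooth_on T f" "smooth_on S (g :: 'e::real_normed_vector \<Rightarrow> 'f)"
  shows "smooth_on S (f \<circ> g)"
  using assms(4,5) unfolding smooth_on_def by (intro allI Ck_on_compose[OF assms(1-3)]) auto

text \<open>A bounded linear map is a bounded bilinear one with the constant \<open>1\<close> as the first factor.\<close>

lemma smooth_on_bounded_linear_compose:
  assumes "bounded_linear h" "open S" "smooth_on S f"
  shows "smooth_on S (\<lambda>x. h (f x))"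
proof -
  interpret bounded_bilinear "\<lambda>(c::real) y. c *\<^sub>R h y"
    using bounded_bilinear.comp[OF bounded_bilinear_scaleR bounded_linear_ident assms(1)] .
  show ?thesis using smooth_on_bilinear[OF assms(2) smooth_on_const[of S 1] assms(3)] by simp
qed

lemma smooth_on_inverse:
  fixes f :: "'e::real_normed_vector \<Rightarrow> 'k::real_normed_field"
  shows "open S \<Longrightarrow> smooth_on S f \<Longrightarrow> (\<And>x. x \<in> S \<Longrightarrow> f x \<noteq> 0) \<Longrightarrow> smooth_on S (\<lambda>x. inverse (f x))"
  by (simp add: smooth_on_def Ck_on_inverse)

lemma smooth_on_dir_deriv: "smooth_on S f \<Longrightarrow> smooth_on S (dir_deriv v f)"
  unfolding smooth_on_def using Ck_on.simps(2) by blast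

lemma smooth_on_iter_dir_deriv: "smooth_on S f \<Longrightarrow> smooth_on S (iter_dir_deriv vs f)"
  by (induction vs) (auto intro: smooth_on_dir_deriv)

lemma smooth_on_imp_differentiable: "smooth_on S f \<Longrightarrow> x \<in> S \<Longrightarrow> f differentiable (at x)"
  unfolding smooth_on_def using Ck_on.simps(2) by blast

lemma smooth_on_imp_continuous_on: "smooth_on S f \<Longrightarrow> continuous_on S f"
  unfolding smooth_on_def using Ck_on.simps(1) by blast

section \<open>Smooth cut-off functions\<close>

text \<open>The functions \<open>exp (- 1 / t) / t ^ n\<close>, extended by zero to \<open>t \<le> 0\<close>. The parameter \<open>n\<close> makes their
  span closed under differentiation, so smoothness follows by induction on the order. The same
  functions with \<open>t = \<epsilon>\<close> serve later as a rapidly decreasing net of positive constants.\<close>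

definition flat :: "nat \<Rightarrow> real \<Rightarrow> real" where
  "flat n t = (if t > 0 then inverse t ^ n * exp (- inverse t) else 0)"

lemma flat_pos: "t > 0 \<Longrightarrow> flat n t > 0" and flat_nonneg: "flat n t \<ge> 0"
  and flat_eq_0: "t \<le> 0 \<Longrightarrow> flat n t = 0"
  by (auto simp: flat_def)

lemma flat_tendsto_0: "(flat n \<longlongrightarrow> 0) (at 0)"
proof (rule filterlim_split_at)
  show "(flat n \<longlongrightarrow> 0) (at_left 0)"
    by (rule tendsto_eventually)
      (auto simp: flat_def eventually_at_left_field intro!: exI[of _ "-1"])
  have "((\<lambda>t::real. inverse t ^ n / exp (inverse t)) \<longlongrightarrow> 0) (at_right 0)"
    using filterlim_compose[OF tendsto_power_div_exp_0 filterlim_inverse_at_top_right] .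
  moreover have "\<forall>\<^sub>F t in at_right 0. inverse t ^ n / exp (inverse t) = flat n t"
    by (auto simp: flat_def exp_minus divide_inverse eventually_at_right_field intro!: exI[of _ "1"])
  ultimately show "(flat n \<longlongrightarrow> 0) (at_right 0)"
    using Lim_transform_eventually by blast
qed

lemma flat_has_derivative:
  "(flat n has_field_derivative flat (n + 2) t - of_nat n * flat (n + 1) t) (at t)"
proof -
  consider "t > 0" | "t < 0" | "t = 0" by linarith
  then show ?thesis
  proof cases
    case 1
    have inv: "(inverse has_field_derivative - (inverse t ^ 2)) (at t)"
      using DERIV_inverse[of t] 1 by (simp add: power2_eq_square)
    have "((\<lambda>t. inverse t ^ n) has_field_derivative - (of_nat n * inverse t ^ (n + 1))) (at t)"
      by (rule DERIV_cong[OF DERIV_power[OF inv]]) (cases n; simp add: power2_eq_square)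
    moreover have "((\<lambda>t. exp (- inverse t)) has_field_derivative inverse t ^ 2 * exp (- inverse t)) (at t)"
      by (rule DERIV_cong[OF DERIV_fun_exp[OF DERIV_minus[OF inv]]]) simp
    ultimately have "((\<lambda>t. inverse t ^ n * exp (- inverse t)) has_field_derivative
        flat (n + 2) t - of_nat n * flat (n + 1) t) (at t)"
      by (rule DERIV_cong[OF DERIV_mult]) (use 1 in \<open>simp add: flat_def power_add power2_eq_square algebra_simps\<close>)
    then show ?thesis
      by (rule has_field_derivative_transform_within_open[where S = "{0<..}"])
        (use 1 in \<open>auto simp: flat_def\<close>)
  next
    case 2
    have "((\<lambda>t. 0) has_field_derivative flat (n + 2) t - of_nat n * flat (n + 1) t) (at t)"
      using 2 by (simp add: flat_eq_0)
    then show ?thesis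
      by (rule has_field_derivative_transform_within_open[where S = "{..<0}"])
        (use 2 in \<open>auto simp: flat_def\<close>)
  next
    case 3
    have "(\<lambda>h. (flat n (0 + h) - flat n 0) / h) = flat (n + 1)"
      by (rule ext) (auto simp: flat_def divide_inverse)
    then show ?thesis
      using 3 flat_tendsto_0[of "n + 1"] by (simp add: DERIV_def flat_eq_0)
  qed
qed

lemma smooth_on_flat: "smooth_on UNIV (flat n)"
  unfolding smooth_on_def
proof
  show "Ck_on k UNIV (flat n)" for k
  proof (induction k arbitrary: n)
    case 0
    show ?case
      using DERIV_isCont[OF flat_has_derivative] by (auto intro!: continuous_at_imp_continuous_on)
  next
    case (Suc k)
    have "dir_deriv v (flat n) = (\<lambda>t. v * (flat (n + 2) t + (- of_nat n) * flat (n + 1) t))" for v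
      using dir_deriv_eq[OF flat_has_derivative[unfolded has_field_derivative_def]] by fastforce
    moreover have "Ck_on k UNIV (\<lambda>t. v * (flat (n + 2) t + (- of_nat n) * flat (n + 1) t))" for v
      by (intro bounded_bilinear.Ck_on_bilinear[OF bounded_bilinear_mult] Ck_on_add Ck_on_const Suc
          open_UNIV)
    moreover have "flat n differentiable (at t)" for t
      using flat_has_derivative[of n t] by (auto simp: real_differentiable_def)
    ultimately show ?case by simp
  qed
qed

text \<open>The usual quotient \<open>a / (a + b)\<close>: \<open>a\<close> vanishes where \<open>dist x y \<ge> 2 * r\<close>, \<open>b\<close> vanishes where
  \<open>dist x y \<le> r\<close>, and never both at once.\<close>

lemma cutoff_exists:
  fixes x :: "'e::real_inner"
  assumes "r > 0"
  obtains \<eta> :: "'e \<Rightarrow> real" where "smooth_on UNIV \<eta>"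
    "\<And>y. y \<in> cball x r \<Longrightarrow> \<eta> y = 1" "\<And>y. y \<notin> cball x (2 * r) \<Longrightarrow> \<eta> y = 0"
proof -
  define s where "s y = (y - x) \<bullet> (y - x)" for y
  define a b where "a = flat 0 \<circ> (\<lambda>y. 4 * r\<^sup>2 + (- 1) * s y)" and "b = flat 0 \<circ> (\<lambda>y. s y + - (r\<^sup>2))"
  have "smooth_on UNIV s"
    unfolding s_def diff_conv_add_uminus
    by (intro smooth_on_inner smooth_on_add open_UNIV smooth_on_const
        smooth_on_bounded_linear[OF bounded_linear_ident])
  then have ab: "smooth_on UNIV a" "smooth_on UNIV b"
    unfolding a_def b_def
    by (intro smooth_on_compose[OF parseval_frame_real, where T = UNIV] smooth_on_flat
        smooth_on_add smooth_on_mult smooth_on_const open_UNIV; simp)+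
  have s: "s y = (dist x y)\<^sup>2" for y
    by (simp add: s_def dist_norm norm_minus_commute dot_square_norm)
  have pos: "a y + b y > 0" for y
  proof (cases "s y < 4 * r\<^sup>2")
    case True
    then show ?thesis using flat_pos flat_nonneg by (simp add: a_def b_def add_pos_nonneg)
  next
    case False
    then have "s y > r\<^sup>2" using assms by (smt (verit) zero_less_power)
    then show ?thesis using flat_pos flat_nonneg by (simp add: a_def b_def add_nonneg_pos)
  qed
  show thesis
  proof (rule that[of "\<lambda>y. a y * inverse (a y + b y)"])
    have "a y + b y \<noteq> 0" for y using pos[of y] by linarith
    then show "smooth_on UNIV (\<lambda>y. a y * inverse (a y + b y))"
      using ab by (intro smooth_on_mult smooth_on_inverse smooth_on_add open_UNIV) auto
  next
    fix y assume "y \<in> cball x r"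
    then have "b y = 0" using s by (simp add: b_def flat_eq_0 power_mono)
    then show "a y * inverse (a y + b y) = 1" using pos[of y] by simp
  next
    fix y assume "y \<notin> cball x (2 * r)"
    then have "(2 * r)\<^sup>2 \<le> s y" unfolding s using assms by (intro power_mono) auto
    then show "a y * inverse (a y + b y) = 0" by (simp add: a_def flat_eq_0 power_mult_distrib)
  qed
qed

section \<open>Growth of nets\<close>

text \<open>Polynomial growth in \<open>1 / \<epsilon>\<close>, and decay faster than every power of \<open>\<epsilon>\<close>, uniformly on \<open>C\<close>. A
  constant factor is absorbed by one more power of \<open>\<epsilon>\<close> (lemma \<open>tempered_onI\<close>), so none appears here.\<close>

definition tempered_on :: "'a set \<Rightarrow> (real \<Rightarrow> 'a \<Rightarrow> 'b::real_normed_vector) \<Rightarrow> bool" where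
  "tempered_on C F \<longleftrightarrow> (\<exists>N::nat. \<forall>\<^sub>F \<epsilon> in at_right 0. \<forall>x\<in>C. norm (F \<epsilon> x) \<le> 1 / \<epsilon> ^ N)"

definition rapid_on :: "'a set \<Rightarrow> (real \<Rightarrow> 'a \<Rightarrow> 'b::real_normed_vector) \<Rightarrow> bool" where
  "rapid_on C F \<longleftrightarrow> (\<forall>m::nat. \<forall>\<^sub>F \<epsilon> in at_right 0. \<forall>x\<in>C. norm (F \<epsilon> x) \<le> \<epsilon> ^ m)"

lemma eventually_at_right_0I:
  assumes "0 < d" "\<And>\<epsilon>::real. 0 < \<epsilon> \<Longrightarrow> \<epsilon> < d \<Longrightarrow> P \<epsilon>"
  shows "eventually P (at_right 0)"
  using assms by (auto simp: eventually_at_right_field)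

lemma eventually_at_right_0_Ioc: "\<forall>\<^sub>F \<epsilon> in at_right 0. \<epsilon> \<in> {0<..1::real}"
  by (rule eventually_at_right_0I[of 1]) auto

lemma inverse_power_mono_exponent:
  "0 < \<epsilon> \<Longrightarrow> \<epsilon> \<le> 1 \<Longrightarrow> m \<le> n \<Longrightarrow> 1 / \<epsilon> ^ m \<le> 1 / (\<epsilon>::real) ^ n"
  by (intro divide_left_mono power_decreasing mult_pos_pos) auto

lemma tempered_onI:
  fixes N :: nat
  assumes "\<forall>\<^sub>F \<epsilon> in at_right 0. \<forall>x\<in>C. norm (F \<epsilon> x) \<le> M / \<epsilon> ^ N"
  shows "tempered_on C F"
  unfolding tempered_on_def
proof (intro exI[of _ "Suc N"])
  have "\<forall>\<^sub>F \<epsilon> in at_right 0. \<epsilon> \<in> {0<..1} \<and> M \<le> 1 / \<epsilon>"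
  proof (rule eventually_at_right_0I[of "1 / (\<bar>M\<bar> + 1)"])
    fix \<epsilon> :: real assume "0 < \<epsilon>" "\<epsilon> < 1 / (\<bar>M\<bar> + 1)"
    then have e: "\<epsilon> * (\<bar>M\<bar> + 1) < 1" by (simp add: field_simps)
    then have "\<epsilon> * \<bar>M\<bar> + \<epsilon> < 1" by (simp add: algebra_simps)
    moreover have "\<epsilon> * M \<le> \<epsilon> * \<bar>M\<bar>" "0 \<le> \<epsilon> * \<bar>M\<bar>" using \<open>0 < \<epsilon>\<close> by auto
    ultimately have "\<epsilon> \<le> 1" "M * \<epsilon> \<le> 1" using \<open>0 < \<epsilon>\<close> by (simp_all only: mult.commute[of M])
    then show "\<epsilon> \<in> {0<..1} \<and> M \<le> 1 / \<epsilon>" using \<open>0 < \<epsilon>\<close> by (simp add: pos_le_divide_eq)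
  qed simp
  with assms show "\<forall>\<^sub>F \<epsilon> in at_right 0. \<forall>x\<in>C. norm (F \<epsilon> x) \<le> 1 / \<epsilon> ^ Suc N"
  proof eventually_elim
    case (elim \<epsilon>)
    then have "M / \<epsilon> ^ N \<le> (1 / \<epsilon>) / \<epsilon> ^ N" by (intro divide_right_mono) auto
    then show ?case using elim(1) by fastforce
  qed
qed

lemma tempered_on_mono:
  assumes "tempered_on C F" "D \<subseteq> C"
    "\<And>\<epsilon> x. \<epsilon> \<in> {0<..1} \<Longrightarrow> x \<in> D \<Longrightarrow> norm (G \<epsilon> x) \<le> norm (F \<epsilon> x)"
  shows "tempered_on D G"
proof -
  obtain N where "\<forall>\<^sub>F \<epsilon> in at_right 0. \<forall>x\<in>C. norm (F \<epsilon> x) \<le> 1 / \<epsilon> ^ N"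
    using assms by (auto simp: tempered_on_def)
  with eventually_at_right_0_Ioc have "\<forall>\<^sub>F \<epsilon> in at_right 0. \<forall>x\<in>D. norm (G \<epsilon> x) \<le> 1 / \<epsilon> ^ N"
  proof eventually_elim
    case (elim \<epsilon>)
    then show ?case using assms(2,3) by (meson order_trans subsetD)
  qed
  then show ?thesis by (auto simp: tempered_on_def)
qed

lemma tempered_on_subset: "tempered_on C F \<Longrightarrow> D \<subseteq> C \<Longrightarrow> tempered_on D F"
  by (erule tempered_on_mono) auto

lemma tempered_on_comp:
  assumes "tempered_on C F" "h ` D \<subseteq> C"
  shows "tempered_on D (\<lambda>\<epsilon> p. F \<epsilon> (h p))"
proof -
  obtain N where "\<forall>\<^sub>F \<epsilon> in at_right 0. \<forall>x\<in>C. norm (F \<epsilon> x) \<le> 1 / \<epsilon> ^ N"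
    using assms by (auto simp: tempered_on_def)
  then have "\<forall>\<^sub>F \<epsilon> in at_right 0. \<forall>p\<in>D. norm (F \<epsilon> (h p)) \<le> 1 / \<epsilon> ^ N"
    by (rule eventually_mono) (use assms(2) in blast)
  then show ?thesis by (auto simp: tempered_on_def)
qed

lemma tempered_on_cong:
  "(\<And>\<epsilon> x. \<epsilon> \<in> {0<..1} \<Longrightarrow> x \<in> C \<Longrightarrow> F \<epsilon> x = G \<epsilon> x) \<Longrightarrow> tempered_on C F \<longleftrightarrow> tempered_on C G"
  using tempered_on_mono[of C F C G] tempered_on_mono[of C G C F] by auto

lemma tempered_on_common_exponent:
  assumes "tempered_on C F" "tempered_on D G"
  obtains N where "\<forall>\<^sub>F \<epsilon> in at_right 0. \<epsilon> \<in> {0<..1} \<and>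
    (\<forall>x\<in>C. norm (F \<epsilon> x) \<le> 1 / \<epsilon> ^ N) \<and> (\<forall>x\<in>D. norm (G \<epsilon> x) \<le> 1 / \<epsilon> ^ N)"
proof -
  obtain N1 N2 where "\<forall>\<^sub>F \<epsilon> in at_right 0. \<forall>x\<in>C. norm (F \<epsilon> x) \<le> 1 / \<epsilon> ^ N1"
    "\<forall>\<^sub>F \<epsilon> in at_right 0. \<forall>x\<in>D. norm (G \<epsilon> x) \<le> 1 / \<epsilon> ^ N2"
    using assms by (auto simp: tempered_on_def)
  with eventually_at_right_0_Ioc have "\<forall>\<^sub>F \<epsilon> in at_right 0. \<epsilon> \<in> {0<..1} \<and>
    (\<forall>x\<in>C. norm (F \<epsilon> x) \<le> 1 / \<epsilon> ^ max N1 N2) \<and> (\<forall>x\<in>D. norm (G \<epsilon> x) \<le> 1 / \<epsilon> ^ max N1 N2)"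
  proof eventually_elim
    case (elim \<epsilon>)
    then show ?case
      using inverse_power_mono_exponent[of \<epsilon> N1 "max N1 N2"]
        inverse_power_mono_exponent[of \<epsilon> N2 "max N1 N2"] by fastforce
  qed
  then show thesis using that by blast
qed

lemma tempered_on_Un:
  assumes "tempered_on C F" "tempered_on D F"
  shows "tempered_on (C \<union> D) F"
proof -
  obtain N where "\<forall>\<^sub>F \<epsilon> in at_right 0. \<epsilon> \<in> {0<..1} \<and>
    (\<forall>x\<in>C. norm (F \<epsilon> x) \<le> 1 / \<epsilon> ^ N) \<and> (\<forall>x\<in>D. norm (F \<epsilon> x) \<le> 1 / \<epsilon> ^ N)"
    using tempered_on_common_exponent[OF assms] .
  then show ?thesis
    unfolding tempered_on_def by (intro exI[of _ N]) (erule eventually_mono, auto)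
qed

text \<open>Finitely many open sets suffice, and the largest of their exponents works for all of \<open>C\<close>.\<close>

lemma tempered_on_compactI:
  assumes "compact C" "\<And>x. x \<in> C \<Longrightarrow> \<exists>T. open T \<and> x \<in> T \<and> tempered_on (C \<inter> T) F"
  shows "tempered_on C F"
proof -
  define \<T> where "\<T> = {T. open T \<and> tempered_on (C \<inter> T) F}"
  have "C \<subseteq> \<Union>\<T>" "\<forall>T\<in>\<T>. open T" using assms(2) by (auto simp: \<T>_def)
  then obtain \<F> where F: "\<F> \<subseteq> \<T>" "finite \<F>" "C \<subseteq> \<Union>\<F>"
    using assms(1) by (metis compactE)
  have "tempered_on (C \<inter> \<Union>\<F>) F"
    using F(2,1)
  proof (induction \<F> rule: finite_induct)
    case empty
    then show ?case by (simp add: tempered_on_def)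
  next
    case (insert T \<F>)
    then show ?case using tempered_on_Un[of "C \<inter> T" F "C \<inter> \<Union>\<F>"]
      by (simp add: \<T>_def Int_Un_distrib)
  qed
  then show ?thesis using F(3) by (simp add: Int_absorb2)
qed

lemma tempered_on_const:
  assumes "bounded (a ` C)"
  shows "tempered_on C (\<lambda>\<epsilon>. a)"
proof -
  obtain M where "\<And>x. x \<in> C \<Longrightarrow> norm (a x) \<le> M"
    using assms by (auto simp: bounded_iff)
  then show ?thesis by (intro tempered_onI[of _ _ M 0]) auto
qed

lemma tempered_on_const_continuous:
  "compact C \<Longrightarrow> continuous_on C a \<Longrightarrow> tempered_on C (\<lambda>\<epsilon>. a)"
  by (intro tempered_on_const compact_imp_bounded compact_continuous_image)

lemma tempered_on_add:
  assumes "tempered_on C F" "tempered_on C G"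
  shows "tempered_on C (\<lambda>\<epsilon> x. F \<epsilon> x + G \<epsilon> x)"
proof -
  obtain N where "\<forall>\<^sub>F \<epsilon> in at_right 0. \<epsilon> \<in> {0<..1} \<and>
    (\<forall>x\<in>C. norm (F \<epsilon> x) \<le> 1 / \<epsilon> ^ N) \<and> (\<forall>x\<in>C. norm (G \<epsilon> x) \<le> 1 / \<epsilon> ^ N)"
    using tempered_on_common_exponent[OF assms] .
  then have "\<forall>\<^sub>F \<epsilon> in at_right 0. \<forall>x\<in>C. norm (F \<epsilon> x + G \<epsilon> x) \<le> 2 / \<epsilon> ^ N"
  proof eventually_elim
    case (elim \<epsilon>)
    show ?case
    proof
      fix x assume "x \<in> C"
      then have "norm (F \<epsilon> x) + norm (G \<epsilon> x) \<le> 1 / \<epsilon> ^ N + 1 / \<epsilon> ^ N"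
        using elim by (intro add_mono) auto
      then show "norm (F \<epsilon> x + G \<epsilon> x) \<le> 2 / \<epsilon> ^ N"
        using norm_triangle_ineq[of "F \<epsilon> x" "G \<epsilon> x"] by simp
    qed
  qed
  then show ?thesis by (rule tempered_onI)
qed

lemma tempered_on_sum:
  "(\<And>i. i \<in> I \<Longrightarrow> tempered_on C (F i)) \<Longrightarrow> tempered_on C (\<lambda>\<epsilon> x. \<Sum>i\<in>I. F i \<epsilon> x)"
proof (induction I rule: infinite_finite_induct)
  case (insert i I)
  then show ?case using tempered_on_add[of C "F i"] by simp
qed (auto intro!: tempered_on_const simp: image_constant_conv)

lemma (in bounded_bilinear) tempered_on_bilinear:
  assumes "tempered_on C F" "tempered_on C G"
  shows "tempered_on C (\<lambda>\<epsilon> x. prod (F \<epsilon> x) (G \<epsilon> x))"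
proof -
  obtain N where N: "\<forall>\<^sub>F \<epsilon> in at_right 0. \<epsilon> \<in> {0<..1} \<and>
    (\<forall>x\<in>C. norm (F \<epsilon> x) \<le> 1 / \<epsilon> ^ N) \<and> (\<forall>x\<in>C. norm (G \<epsilon> x) \<le> 1 / \<epsilon> ^ N)"
    using tempered_on_common_exponent[OF assms] .
  obtain K where K: "K > 0" "\<And>a b. norm (prod a b) \<le> norm a * norm b * K"
    using pos_bounded by blast
  have "\<forall>\<^sub>F \<epsilon> in at_right 0. \<forall>x\<in>C. norm (prod (F \<epsilon> x) (G \<epsilon> x)) \<le> K / \<epsilon> ^ (N + N)"
    using N
  proof eventually_elim
    case (elim \<epsilon>)
    show ?case
    proof
      fix x assume "x \<in> C"
      then have "norm (F \<epsilon> x) * norm (G \<epsilon> x) * K \<le> (1 / \<epsilon> ^ N) * (1 / \<epsilon> ^ N) * K"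
        using elim K(1) by (intro mult_mono) auto
      then show "norm (prod (F \<epsilon> x) (G \<epsilon> x)) \<le> K / \<epsilon> ^ (N + N)"
        using K(2)[of "F \<epsilon> x" "G \<epsilon> x"] by (simp add: power_add)
    qed
  qed
  then show ?thesis by (rule tempered_onI)
qed

lemma rapid_on_add:
  assumes "rapid_on C F" "rapid_on C G"
  shows "rapid_on C (\<lambda>\<epsilon> x. F \<epsilon> x + G \<epsilon> x)"
  unfolding rapid_on_def
proof
  fix m :: nat
  have "\<forall>\<^sub>F \<epsilon> in at_right 0. \<epsilon> \<in> {0<..<1 / 2 :: real}"
    by (rule eventually_at_right_0I[of "1 / 2"]) auto
  moreover have "\<forall>\<^sub>F \<epsilon> in at_right 0. \<forall>x\<in>C. norm (F \<epsilon> x) \<le> \<epsilon> ^ Suc m"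
    "\<forall>\<^sub>F \<epsilon> in at_right 0. \<forall>x\<in>C. norm (G \<epsilon> x) \<le> \<epsilon> ^ Suc m"
    using assms unfolding rapid_on_def by blast+
  ultimately show "\<forall>\<^sub>F \<epsilon> in at_right 0. \<forall>x\<in>C. norm (F \<epsilon> x + G \<epsilon> x) \<le> \<epsilon> ^ m"
  proof eventually_elim
    case (elim \<epsilon>)
    have "\<epsilon> ^ Suc m + \<epsilon> ^ Suc m \<le> \<epsilon> ^ m"
      using elim(1) mult_right_mono[of "2 * \<epsilon>" 1 "\<epsilon> ^ m"] by simp
    moreover have "norm (F \<epsilon> x + G \<epsilon> x) \<le> \<epsilon> ^ Suc m + \<epsilon> ^ Suc m" if "x \<in> C" for x
      using elim(2,3) that by (intro norm_triangle_mono) auto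
    ultimately show ?case using order_trans by blast
  qed
qed

lemma tempered_rapid_mult:
  fixes F G :: "real \<Rightarrow> 'a \<Rightarrow> 'k::real_normed_field"
  assumes "tempered_on C F" "rapid_on C G"
  shows "rapid_on C (\<lambda>\<epsilon> x. F \<epsilon> x * G \<epsilon> x)"
  unfolding rapid_on_def
proof
  fix m :: nat
  obtain N where N: "\<forall>\<^sub>F \<epsilon> in at_right 0. \<forall>x\<in>C. norm (F \<epsilon> x) \<le> 1 / \<epsilon> ^ N"
    using assms(1) by (auto simp: tempered_on_def)
  moreover have "\<forall>\<^sub>F \<epsilon> in at_right 0. \<forall>x\<in>C. norm (G \<epsilon> x) \<le> \<epsilon> ^ (N + m)"
    using assms(2) unfolding rapid_on_def by blast
  ultimately show "\<forall>\<^sub>F \<epsilon> in at_right 0. \<forall>x\<in>C. norm (F \<epsilon> x * G \<epsilon> x) \<le> \<epsilon> ^ m"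
    using eventually_at_right_0_Ioc
  proof eventually_elim
    case (elim \<epsilon>)
    show ?case
    proof
      fix x assume "x \<in> C"
      then have "norm (F \<epsilon> x) * norm (G \<epsilon> x) \<le> (1 / \<epsilon> ^ N) * \<epsilon> ^ (N + m)"
        using elim by (intro mult_mono) auto
      also have "\<dots> = \<epsilon> ^ m" using elim(3) by (simp add: power_add)
      finally show "norm (F \<epsilon> x * G \<epsilon> x) \<le> \<epsilon> ^ m" by (simp add: norm_mult)
    qed
  qed
qed

subsection \<open>Nets of functions whose derivatives are all tempered\<close>

text \<open>The recursion mirrors \<open>Ck_on\<close>, peeling off the innermost derivative first. Products and inverses
  are then handled by induction on the order, without an explicit Leibniz formula.\<close>

fun Ck_tempered ::
    "nat \<Rightarrow> 'e::real_normed_vector set \<Rightarrow> (real \<Rightarrow> 'e \<Rightarrow> 'b::real_normed_vector) \<Rightarrow> bool" where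
  "Ck_tempered 0 S F \<longleftrightarrow> (\<forall>C. compact C \<longrightarrow> C \<subseteq> S \<longrightarrow> tempered_on C F)"
| "Ck_tempered (Suc k) S F \<longleftrightarrow>
     Ck_tempered 0 S F \<and> (\<forall>v. Ck_tempered k S (\<lambda>\<epsilon>. dir_deriv v (F \<epsilon>)))"

definition smooth_tempered ::
    "'e::real_normed_vector set \<Rightarrow> (real \<Rightarrow> 'e \<Rightarrow> 'b::real_normed_vector) \<Rightarrow> bool" where
  "smooth_tempered S F \<longleftrightarrow> (\<forall>\<epsilon>\<in>{0<..1}. smooth_on S (F \<epsilon>)) \<and> (\<forall>k. Ck_tempered k S F)"

lemma Ck_tempered_SucD: "Ck_tempered (Suc k) S F \<Longrightarrow> Ck_tempered k S F"
  by (induction k arbitrary: F) auto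

lemma Ck_tempered_cong:
  assumes "open S" "\<And>\<epsilon> x. \<epsilon> \<in> {0<..1} \<Longrightarrow> x \<in> S \<Longrightarrow> F \<epsilon> x = G \<epsilon> x"
  shows "Ck_tempered k S F \<longleftrightarrow> Ck_tempered k S G"
  using assms(2)
proof (induction k arbitrary: F G)
  case 0
  then have "tempered_on C F \<longleftrightarrow> tempered_on C G" if "C \<subseteq> S" for C
    using that by (intro tempered_on_cong) blast
  then show ?case by auto
next
  case (Suc k)
  have "tempered_on C F \<longleftrightarrow> tempered_on C G" if "C \<subseteq> S" for C
    using that Suc.prems by (intro tempered_on_cong) blast
  moreover have "Ck_tempered k S (\<lambda>\<epsilon>. dir_deriv v (F \<epsilon>)) \<longleftrightarrow> Ck_tempered k S (\<lambda>\<epsilon>. dir_deriv v (G \<epsilon>))"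
    for v
    using Suc.prems by (intro Suc.IH dir_deriv_cong_open[OF assms(1)]) auto
  ultimately show ?case by auto
qed

lemma Ck_tempered_add:
  assumes "open S" "\<And>\<epsilon>. \<epsilon> \<in> {0<..1} \<Longrightarrow> smooth_on S (F \<epsilon>)" "\<And>\<epsilon>. \<epsilon> \<in> {0<..1} \<Longrightarrow> smooth_on S (G \<epsilon>)"
    and "Ck_tempered k S F" "Ck_tempered k S G"
  shows "Ck_tempered k S (\<lambda>\<epsilon> x. F \<epsilon> x + G \<epsilon> x)"
  using assms(2-)
proof (induction k arbitrary: F G)
  case 0
  then show ?case by (auto intro: tempered_on_add)
next
  case (Suc k)
  have "Ck_tempered k S (\<lambda>\<epsilon>. dir_deriv v (\<lambda>x. F \<epsilon> x + G \<epsilon> x))" for v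
  proof (subst Ck_tempered_cong[OF assms(1)])
    show "dir_deriv v (\<lambda>x. F \<epsilon> x + G \<epsilon> x) x = dir_deriv v (F \<epsilon>) x + dir_deriv v (G \<epsilon>) x"
      if "\<epsilon> \<in> {0<..1}" "x \<in> S" for \<epsilon> x
      using that Suc.prems by (intro dir_deriv_add) (blast intro: smooth_on_imp_differentiable)+
    show "Ck_tempered k S (\<lambda>\<epsilon> x. dir_deriv v (F \<epsilon>) x + dir_deriv v (G \<epsilon>) x)"
      using Suc.prems by (intro Suc.IH smooth_on_dir_deriv) auto
  qed
  then show ?case using Suc.prems by (auto intro: tempered_on_add)
qed

lemma (in bounded_bilinear) Ck_tempered_bilinear:
  assumes "open S" "\<And>\<epsilon>. \<epsilon> \<in> {0<..1} \<Longrightarrow> smooth_on S (F \<epsilon>)" "\<And>\<epsilon>. \<epsilon> \<in> {0<..1} \<Longrightarrow> smooth_on S (G \<epsilon>)"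
    and "Ck_tempered k S F" "Ck_tempered k S G"
  shows "Ck_tempered k S (\<lambda>\<epsilon> x. prod (F \<epsilon> x) (G \<epsilon> x))"
  using assms(2-)
proof (induction k arbitrary: F G)
  case 0
  then show ?case by (auto intro: tempered_on_bilinear)
next
  case (Suc k)
  have "Ck_tempered k S (\<lambda>\<epsilon>. dir_deriv v (\<lambda>x. prod (F \<epsilon> x) (G \<epsilon> x)))" for v
  proof (subst Ck_tempered_cong[OF assms(1)])
    show "dir_deriv v (\<lambda>x. prod (F \<epsilon> x) (G \<epsilon> x)) x
        = prod (F \<epsilon> x) (dir_deriv v (G \<epsilon>) x) + prod (dir_deriv v (F \<epsilon>) x) (G \<epsilon> x)"
      if "\<epsilon> \<in> {0<..1}" "x \<in> S" for \<epsilon> x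
      using that Suc.prems by (intro dir_deriv_bilinear) (blast intro: smooth_on_imp_differentiable)+
    show "Ck_tempered k S
        (\<lambda>\<epsilon> x. prod (F \<epsilon> x) (dir_deriv v (G \<epsilon>) x) + prod (dir_deriv v (F \<epsilon>) x) (G \<epsilon> x))"
      using Suc.prems Ck_tempered_SucD[of k S F] Ck_tempered_SucD[of k S G]
      by (intro Ck_tempered_add[OF assms(1)] Suc.IH smooth_on_bilinear[OF assms(1)]
          smooth_on_dir_deriv) auto
  qed
  then show ?case using Suc.prems by (auto intro: tempered_on_bilinear)
qed

lemma Ck_tempered_const: 
  assumes "tempered_on UNIV (\<lambda>\<epsilon> x::'e::real_normed_vector. c \<epsilon> :: 'b::real_normed_vector)"
  shows "Ck_tempered k (S :: 'e set) (\<lambda>\<epsilon> x. c \<epsilon>)"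
  using assms
proof (induction k arbitrary: c)
  case 0
  then show ?case using tempered_on_subset by auto
next
  case (Suc k)
  have "dir_deriv v (\<lambda>x. c \<epsilon>) = (\<lambda>x. 0)" for v :: 'e and \<epsilon>
    by (rule ext, subst dir_deriv_eq[OF has_derivative_const]) simp
  then show ?case
    using Suc.IH[of "\<lambda>_. 0"] tempered_on_subset[OF Suc.prems]
tempered_on_const[of "\<lambda>_. 0 :: 'b" UNIV]
    by (simp add: image_constant_conv)
qed

text \<open>Differentiating an inverse only produces products of derivatives of \<open>F\<close> and of the inverse itself.
  Hence a bound of order zero on the inverse controls all of its derivatives.\<close>

lemma Ck_tempered_inverse:
  fixes F :: "real \<Rightarrow> 'e::real_normed_vector \<Rightarrow> 'k::real_normed_field"
  assumes "open S" and smooth: "\<And>\<epsilon>. \<epsilon> \<in> {0<..1} \<Longrightarrow> smooth_on S (F \<epsilon>)"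
    and nz: "\<And>\<epsilon> x. \<epsilon> \<in> {0<..1} \<Longrightarrow> x \<in> S \<Longrightarrow> F \<epsilon> x \<noteq> 0"
    and "Ck_tempered k S F" and inv0: "Ck_tempered 0 S (\<lambda>\<epsilon> x. inverse (F \<epsilon> x))"
  shows "Ck_tempered k S (\<lambda>\<epsilon> x. inverse (F \<epsilon> x))"
  using assms(4)
proof (induction k)
  case (Suc k)
  note mult = bounded_bilinear.Ck_tempered_bilinear[OF bounded_bilinear_mult assms(1)]
  have inv: "Ck_tempered k S (\<lambda>\<epsilon> x. inverse (F \<epsilon> x))" using Suc Ck_tempered_SucD by blast
  have "Ck_tempered k S (\<lambda>\<epsilon>. dir_deriv v (\<lambda>x. inverse (F \<epsilon> x)))" for v
  proof (subst Ck_tempered_cong[OF assms(1)])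
    show "dir_deriv v (\<lambda>x. inverse (F \<epsilon> x)) x
        = (- 1) * (dir_deriv v (F \<epsilon>) x * (inverse (F \<epsilon> x) * inverse (F \<epsilon> x)))"
      if "\<epsilon> \<in> {0<..1}" "x \<in> S" for \<epsilon> x
      using that smooth nz by (subst dir_deriv_inverse) (auto intro: smooth_on_imp_differentiable)
    show "Ck_tempered k S
        (\<lambda>\<epsilon> x. (- 1) * (dir_deriv v (F \<epsilon>) x * (inverse (F \<epsilon> x) * inverse (F \<epsilon> x))))"
      using Suc.prems inv smooth nz
      by (intro mult Ck_tempered_const tempered_on_const smooth_on_mult smooth_on_inverse
          smooth_on_dir_deriv smooth_on_const assms(1)) auto
  qed
  then show ?case using inv0 by simp
qed (use inv0 in simp)

text \<open>The recursion strips the innermost derivative, which is the last entry of the list of directions;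
  hence the induction from the right.\<close>

lemma Ck_tempered_iff_iter_dir_deriv:
  "(\<forall>k. Ck_tempered k S F) \<longleftrightarrow>
    (\<forall>vs C. compact C \<longrightarrow> C \<subseteq> S \<longrightarrow> tempered_on C (\<lambda>\<epsilon>. iter_dir_deriv vs (F \<epsilon>)))"
proof
  assume *: "\<forall>k. Ck_tempered k S F"
  have "Ck_tempered (length vs) S F \<Longrightarrow> compact C \<Longrightarrow> C \<subseteq> S \<Longrightarrow>
      tempered_on C (\<lambda>\<epsilon>. iter_dir_deriv vs (F \<epsilon>))" for vs C
    by (induction vs arbitrary: F rule: rev_induct) (auto simp: iter_dir_deriv_snoc)
  with * show "\<forall>vs C. compact C \<longrightarrow> C \<subseteq> S \<longrightarrow> tempered_on C (\<lambda>\<epsilon>. iter_dir_deriv vs (F \<epsilon>))" by blast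
next
  assume *: "\<forall>vs C. compact C \<longrightarrow> C \<subseteq> S \<longrightarrow> tempered_on C (\<lambda>\<epsilon>. iter_dir_deriv vs (F \<epsilon>))"
  have "Ck_tempered k S F" for k
    using *
  proof (induction k arbitrary: F)
    case 0
    then show ?case using iter_dir_deriv.simps(1) by (metis (no_types, lifting) Ck_tempered.simps(1) ext)
  next
    case (Suc k)
    have "Ck_tempered k S (\<lambda>\<epsilon>. dir_deriv v (F \<epsilon>))" for v
      using Suc.prems by (intro Suc.IH) (simp add: iter_dir_deriv_snoc[symmetric])
    moreover have "tempered_on C F" if "compact C" "C \<subseteq> S" for C
      using Suc.prems[rule_format, OF that, of "[]"] by simp
    ultimately show ?case by simp
  qed
  then show "\<forall>k. Ck_tempered k S F" ..
qed

section \<open>Smooth functions and differential operators on a manifold\<close>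

locale smooth_manifold =
  fixes A :: "('a::t2_space, 'e::real_inner) chart set"
  assumes atlas: "smooth_atlas A"
begin

lemma frame_exists: obtains E :: "'e set" where "parseval_frame E"
  using atlas parseval_frame_exists unfolding smooth_atlas_def by metis

lemma chart:
  assumes "(U, \<phi>) \<in> A"
  shows "open U" "open (\<phi> ` U)"
    and "continuous_on U \<phi>" "continuous_on (\<phi> ` U) (inv_into U \<phi>)"
    and "\<And>p. p \<in> U \<Longrightarrow> inv_into U \<phi> (\<phi> p) = p"
      "\<And>x. x \<in> \<phi> ` U \<Longrightarrow> inv_into U \<phi> x \<in> U"
      "\<And>x. x \<in> \<phi> ` U \<Longrightarrow> \<phi> (inv_into U \<phi> x) = x"
proof -
  have "is_chart (U, \<phi>)" using atlas assms by (auto simp: smooth_atlas_def)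
  then have *: "open U" "open (\<phi> ` U)" "homeomorphism U (\<phi> ` U) \<phi> (inv_into U \<phi>)"
    by (auto simp: is_chart_def)
  show "open U" "open (\<phi> ` U)" "continuous_on U \<phi>" "continuous_on (\<phi> ` U) (inv_into U \<phi>)"
    "\<And>p. p \<in> U \<Longrightarrow> inv_into U \<phi> (\<phi> p) = p"
    using * by (auto simp: homeomorphism_def)
  show "x \<in> \<phi> ` U \<Longrightarrow> inv_into U \<phi> x \<in> U" "x \<in> \<phi> ` U \<Longrightarrow> \<phi> (inv_into U \<phi> x) = x" for x
    by (auto intro: inv_into_into f_inv_into_f)
qed

lemma chart_cover: obtains U \<phi> where "(U, \<phi>) \<in> A" "p \<in> U"
  using atlas unfolding smooth_atlas_def by blast

lemma transition_smooth:
  "(U, \<phi>) \<in> A \<Longrightarrow> (V, \<psi>) \<in> A \<Longrightarrow> smooth_on (\<phi> ` (U \<inter> V)) (\<psi> \<circ> inv_into U \<phi>)"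
  using atlas unfolding smooth_atlas_def by blast

lemma chart_image_open:
  assumes "(U, \<phi>) \<in> A" "open W"
  shows "open (\<phi> ` (U \<inter> W))"
proof -
  have "\<phi> ` (U \<inter> W) = inv_into U \<phi> -` W \<inter> \<phi> ` U"
    using chart(5,6,7)[OF assms(1)] by (auto simp: image_iff)
  then show ?thesis
    using continuous_on_open_vimage[OF chart(2)[OF assms(1)], THEN iffD1, OF chart(4)[OF assms(1)]]
      assms(2) by simp
qed

lemma chart_preimage_compact:
  assumes "(U, \<phi>) \<in> A" "compact C" "C \<subseteq> \<phi> ` U"
  shows "compact (inv_into U \<phi> ` C)"
  by (rule compact_continuous_image[OF continuous_on_subset[OF chart(4)[OF assms(1)] assms(3)] assms(2)])

lemma smooth_functionsD:
  "f \<in> smooth_functions A \<Longrightarrow> (U, \<phi>) \<in> A \<Longrightarrow> smooth_on (\<phi> ` U) (f \<circ> inv_into U \<phi>)"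
  by (auto simp: smooth_functions_def)

lemma smooth_functionsI:
  "(\<And>U \<phi>. (U, \<phi>) \<in> A \<Longrightarrow> smooth_on (\<phi> ` U) (f \<circ> inv_into U \<phi>)) \<Longrightarrow> f \<in> smooth_functions A"
  by (auto simp: smooth_functions_def)

lemma smooth_functions_continuous_on:
  assumes "f \<in> smooth_functions A"
  shows "continuous_on S f"
proof -
  have "isCont f p" for p
  proof -
    obtain U \<phi> where U: "(U, \<phi>) \<in> A" "p \<in> U" using chart_cover .
    have "continuous_on U ((f \<circ> inv_into U \<phi>) \<circ> \<phi>)"
      by (rule continuous_on_compose[OF chart(3)[OF U(1)]
            smooth_on_imp_continuous_on[OF smooth_functionsD[OF assms U(1)]]])
    then have "continuous_on U f"
      by (rule continuous_on_eq) (simp add: chart(5)[OF U(1)])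
    then show ?thesis using U chart(1)[OF U(1)] by (simp add: continuous_on_eq_continuous_at)
  qed
  then show ?thesis by (simp add: continuous_at_imp_continuous_on)
qed

end

text \<open>The local form of a differential operator in one chart. The lemmas below show that it is closed
  under sums, so that an operator can be given as any finite sum of monomials, without collecting
  the terms that belong to the same list of directions.\<close>

definition diff_form ::
    "nat \<Rightarrow> 'e::real_normed_vector set \<Rightarrow> (('e \<Rightarrow> 'k::real_normed_field) \<Rightarrow> 'e \<Rightarrow> 'k) \<Rightarrow> bool" where
  "diff_form k S T \<longleftrightarrow> (\<exists>L a. finite L \<and> (\<forall>vs\<in>L. length vs \<le> k \<and> smooth_on S (a vs)) \<and>
     (\<forall>g. \<forall>x\<in>S. T g x = (\<Sum>vs\<in>L. a vs x * iter_dir_deriv vs g x)))"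

lemma diff_form_monomial:
  assumes "length vs \<le> k" "smooth_on S c"
  shows "diff_form k S (\<lambda>g x. c x * iter_dir_deriv vs g x)"
  unfolding diff_form_def using assms by (intro exI[of _ "{vs}"] exI[of _ "\<lambda>_. c"]) auto

lemma diff_form_add:
  assumes "open S" "diff_form k S T1" "diff_form k S T2"
  shows "diff_form k S (\<lambda>g x. T1 g x + T2 g x)"
proof -
  obtain L1 a1 where 1: "finite L1" "\<forall>vs\<in>L1. length vs \<le> k \<and> smooth_on S (a1 vs)"
    "\<forall>g. \<forall>x\<in>S. T1 g x = (\<Sum>vs\<in>L1. a1 vs x * iter_dir_deriv vs g x)"
    using assms(2) unfolding diff_form_def by blast
  obtain L2 a2 where 2: "finite L2" "\<forall>vs\<in>L2. length vs \<le> k \<and> smooth_on S (a2 vs)"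
    "\<forall>g. \<forall>x\<in>S. T2 g x = (\<Sum>vs\<in>L2. a2 vs x * iter_dir_deriv vs g x)"
    using assms(3) unfolding diff_form_def by blast
  define a where "a vs x = (if vs \<in> L1 then a1 vs x else 0) + (if vs \<in> L2 then a2 vs x else 0)" for vs x
  have "smooth_on S (a vs)" for vs
  proof -
    have "smooth_on S (\<lambda>x. if vs \<in> L1 then a1 vs x else 0)" "smooth_on S (\<lambda>x. if vs \<in> L2 then a2 vs x else 0)"
      using 1 2 by (cases "vs \<in> L1"; cases "vs \<in> L2"; simp add: smooth_on_const)+
    then show ?thesis unfolding a_def by (rule smooth_on_add[OF assms(1)])
  qed
  moreover have "T1 g x + T2 g x = (\<Sum>vs\<in>L1 \<union> L2. a vs x * iter_dir_deriv vs g x)" if "x \<in> S" for g x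
  proof -
    have "(\<Sum>vs\<in>L1 \<union> L2. a vs x * iter_dir_deriv vs g x)
      = (\<Sum>vs\<in>L1 \<union> L2. if vs \<in> L1 then a1 vs x * iter_dir_deriv vs g x else 0)
      + (\<Sum>vs\<in>L1 \<union> L2. if vs \<in> L2 then a2 vs x * iter_dir_deriv vs g x else 0)"
      unfolding sum.distrib[symmetric] by (intro sum.cong) (auto simp: a_def distrib_right)
    also have "\<dots> = (\<Sum>vs\<in>(L1 \<union> L2) \<inter> L1. a1 vs x * iter_dir_deriv vs g x)
      + (\<Sum>vs\<in>(L1 \<union> L2) \<inter> L2. a2 vs x * iter_dir_deriv vs g x)"
      using 1(1) 2(1) by (simp only: sum.inter_restrict finite_UnI)
    also have "\<dots> = T1 g x + T2 g x"
      using 1 2 that by (simp add: Int_absorb1 Int_absorb2)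
    finally show ?thesis by simp
  qed
  ultimately show ?thesis
    unfolding diff_form_def using 1 2 by (intro exI[of _ "L1 \<union> L2"] exI[of _ a]) auto
qed

lemma diff_form_sum:
  assumes "open S" "\<And>i. i \<in> I \<Longrightarrow> diff_form k S (T i)"
  shows "diff_form k S (\<lambda>g x. \<Sum>i\<in>I. T i g x)"
  using assms(2)
proof (induction I rule: infinite_finite_induct)
  case (insert i I)
  then show ?case using diff_form_add[OF assms(1), of k "T i"] by simp
qed (auto simp: diff_form_def intro!: exI[of _ "{}"])

context smooth_manifold
begin

lemma linear_diff_op_iff_diff_form:
  "linear_diff_op A P \<longleftrightarrow> (\<exists>k. \<forall>(U, \<phi>)\<in>A. \<exists>T. diff_form k (\<phi> ` U) T \<and>
     (\<forall>f\<in>smooth_functions A. \<forall>p\<in>U. P f p = T (f \<circ> inv_into U \<phi>) (\<phi> p)))"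
proof
  assume "linear_diff_op A P"
  then obtain k where k: "\<forall>(U, \<phi>)\<in>A. \<exists>L a. finite L \<and>
      (\<forall>vs\<in>L. length vs \<le> k \<and> smooth_on (\<phi> ` U) (a vs)) \<and>
      (\<forall>f\<in>smooth_functions A. \<forall>p\<in>U.
         P f p = (\<Sum>vs\<in>L. a vs (\<phi> p) * iter_dir_deriv vs (f \<circ> inv_into U \<phi>) (\<phi> p)))"
    unfolding linear_diff_op_def by blast
  have "\<exists>T. diff_form k (\<phi> ` U) T \<and>
     (\<forall>f\<in>smooth_functions A. \<forall>p\<in>U. P f p = T (f \<circ> inv_into U \<phi>) (\<phi> p))" if U: "(U, \<phi>) \<in> A" for U \<phi>
  proof -
    obtain L a where "finite L" "\<forall>vs\<in>L. length vs \<le> k \<and> smooth_on (\<phi> ` U) (a vs)"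
      "\<forall>f\<in>smooth_functions A. \<forall>p\<in>U.
         P f p = (\<Sum>vs\<in>L. a vs (\<phi> p) * iter_dir_deriv vs (f \<circ> inv_into U \<phi>) (\<phi> p))"
      using bspec[OF k U] by auto
    then show ?thesis
      by (intro exI[of _ "\<lambda>g x. \<Sum>vs\<in>L. a vs x * iter_dir_deriv vs g x"])
        (auto simp: diff_form_def intro!: exI[of _ L] exI[of _ a])
  qed
  then show "\<exists>k. \<forall>(U, \<phi>)\<in>A. \<exists>T. diff_form k (\<phi> ` U) T \<and>
     (\<forall>f\<in>smooth_functions A. \<forall>p\<in>U. P f p = T (f \<circ> inv_into U \<phi>) (\<phi> p))"
    by (intro exI[of _ k]) auto
next
  assume "\<exists>k. \<forall>(U, \<phi>)\<in>A. \<exists>T. diff_form k (\<phi> ` U) T \<and>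
     (\<forall>f\<in>smooth_functions A. \<forall>p\<in>U. P f p = T (f \<circ> inv_into U \<phi>) (\<phi> p))"
  then obtain k where k: "\<And>U \<phi>. (U, \<phi>) \<in> A \<Longrightarrow> \<exists>T. diff_form k (\<phi> ` U) T \<and>
     (\<forall>f\<in>smooth_functions A. \<forall>p\<in>U. P f p = T (f \<circ> inv_into U \<phi>) (\<phi> p))"
    by fast
  have "\<exists>L a. finite L \<and> (\<forall>vs\<in>L. length vs \<le> k \<and> smooth_on (\<phi> ` U) (a vs)) \<and>
      (\<forall>f\<in>smooth_functions A. \<forall>p\<in>U.
         P f p = (\<Sum>vs\<in>L. a vs (\<phi> p) * iter_dir_deriv vs (f \<circ> inv_into U \<phi>) (\<phi> p)))"
    if U: "(U, \<phi>) \<in> A" for U \<phi>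
  proof -
    obtain T where T: "diff_form k (\<phi> ` U) T"
      "\<forall>f\<in>smooth_functions A. \<forall>p\<in>U. P f p = T (f \<circ> inv_into U \<phi>) (\<phi> p)" using k[OF U] by blast
    then obtain L a where "finite L" "\<forall>vs\<in>L. length vs \<le> k \<and> smooth_on (\<phi> ` U) (a vs)"
      "\<forall>g. \<forall>x\<in>\<phi> ` U. T g x = (\<Sum>vs\<in>L. a vs x * iter_dir_deriv vs g x)"
      unfolding diff_form_def by blast
    then show ?thesis using T(2) by (intro exI[of _ L] exI[of _ a]) auto
  qed
  then show "linear_diff_op A P" unfolding linear_diff_op_def by (intro exI[of _ k]) auto
qed

lemma linear_diff_op_id: "linear_diff_op A (\<lambda>f. f)"
  unfolding linear_diff_op_iff_diff_form
proof (intro exI[of _ 0] ballI, clarify)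
  fix U \<phi> assume U: "(U, \<phi>) \<in> A"
  have "diff_form 0 (\<phi> ` U) (\<lambda>g x. 1 * iter_dir_deriv [] g x)"
    by (intro diff_form_monomial smooth_on_const) simp
  then show "\<exists>T. diff_form 0 (\<phi> ` U) T \<and>
      (\<forall>f\<in>smooth_functions A. \<forall>p\<in>U. f p = T (f \<circ> inv_into U \<phi>) (\<phi> p))"
    using chart(5)[OF U] by (intro exI conjI) auto
qed

lemma linear_diff_op_chartE:
  assumes "linear_diff_op A P" "(U, \<phi>) \<in> A"
  obtains L a where "finite L" "\<And>vs. vs \<in> L \<Longrightarrow> smooth_on (\<phi> ` U) (a vs)"
    "\<And>f p. f \<in> smooth_functions A \<Longrightarrow> p \<in> U \<Longrightarrow>
       P f p = (\<Sum>vs\<in>L. a vs (\<phi> p) * iter_dir_deriv vs (f \<circ> inv_into U \<phi>) (\<phi> p))"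
  using assms unfolding linear_diff_op_def by fast

lemma linear_diff_op_smooth:
  assumes P: "linear_diff_op A P" and f: "f \<in> smooth_functions A"
  shows "P f \<in> smooth_functions A"
proof (rule smooth_functionsI)
  fix U \<phi> assume U: "(U, \<phi>) \<in> A"
  note op = chart(2)[OF U]
  obtain L a where L: "finite L" "\<And>vs. vs \<in> L \<Longrightarrow> smooth_on (\<phi> ` U) (a vs)"
    "\<And>f p. f \<in> smooth_functions A \<Longrightarrow> p \<in> U \<Longrightarrow>
       P f p = (\<Sum>vs\<in>L. a vs (\<phi> p) * iter_dir_deriv vs (f \<circ> inv_into U \<phi>) (\<phi> p))"
    using linear_diff_op_chartE[OF P U] by blast
  have "smooth_on (\<phi> ` U) (\<lambda>x. \<Sum>vs\<in>L. a vs x * iter_dir_deriv vs (f \<circ> inv_into U \<phi>) x)"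
    using L(2) by (intro smooth_on_sum smooth_on_mult op smooth_on_iter_dir_deriv
        smooth_functionsD[OF f U])
  then show "smooth_on (\<phi> ` U) (P f \<circ> inv_into U \<phi>)"
    by (rule smooth_on_cong[OF op, THEN iffD1, rotated]) (use L(3)[OF f] chart(6,7)[OF U] in auto)
qed

text \<open>A first order operator without zeroth order term. Coordinate derivatives are of this kind, and
  iterated derivatives are compositions of them.\<close>

definition vector_field_op :: "'e set \<Rightarrow> (('a \<Rightarrow> 'k::real_normed_field) \<Rightarrow> 'a \<Rightarrow> 'k) \<Rightarrow> bool" where
  "vector_field_op E X \<longleftrightarrow> (\<forall>(U, \<phi>)\<in>A. \<exists>c. (\<forall>b\<in>E. smooth_on (\<phi> ` U) (c b)) \<and>
     (\<forall>f\<in>smooth_functions A. \<forall>p\<in>U.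
        X f p = (\<Sum>b\<in>E. c b (\<phi> p) * dir_deriv b (f \<circ> inv_into U \<phi>) (\<phi> p))))"

text \<open>The product rule splits \<open>c \<partial> (a D f)\<close>, for \<open>D\<close> an iterated derivative of order at most \<open>k\<close>, into
  \<open>(c a) \<partial> D f\<close> of order at most \<open>k + 1\<close> and \<open>(c \<partial>a) D f\<close> of order at most \<open>k\<close>.\<close>

lemma linear_diff_op_vector_field_comp:
  assumes P: "linear_diff_op A P" and X: "vector_field_op E X"
  shows "linear_diff_op A (\<lambda>f. X (P f))"
proof -
  obtain k where k: "\<And>U \<phi>. (U, \<phi>) \<in> A \<Longrightarrow> \<exists>L a. finite L \<and>
      (\<forall>vs\<in>L. length vs \<le> k \<and> smooth_on (\<phi> ` U) (a vs)) \<and>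
      (\<forall>f\<in>smooth_functions A. \<forall>p\<in>U.
         P f p = (\<Sum>vs\<in>L. a vs (\<phi> p) * iter_dir_deriv vs (f \<circ> inv_into U \<phi>) (\<phi> p)))"
    using P unfolding linear_diff_op_def by fast
  have "\<exists>T. diff_form (Suc k) (\<phi> ` U) T \<and>
      (\<forall>f\<in>smooth_functions A. \<forall>p\<in>U. X (P f) p = T (f \<circ> inv_into U \<phi>) (\<phi> p))"
    if U: "(U, \<phi>) \<in> A" for U \<phi>
  proof -
    note op = chart(2)[OF U]
    obtain L a where La: "finite L" "\<forall>vs\<in>L. length vs \<le> k \<and> smooth_on (\<phi> ` U) (a vs)"
      "\<forall>f\<in>smooth_functions A. \<forall>p\<in>U.
         P f p = (\<Sum>vs\<in>L. a vs (\<phi> p) * iter_dir_deriv vs (f \<circ> inv_into U \<phi>) (\<phi> p))"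
      using k[OF U] by blast
    then have L: "\<And>vs. vs \<in> L \<Longrightarrow> length vs \<le> k" "\<And>vs. vs \<in> L \<Longrightarrow> smooth_on (\<phi> ` U) (a vs)"
      by auto
    obtain c where c: "\<And>b. b \<in> E \<Longrightarrow> smooth_on (\<phi> ` U) (c b)"
      "\<And>f p. f \<in> smooth_functions A \<Longrightarrow> p \<in> U \<Longrightarrow>
        X f p = (\<Sum>b\<in>E. c b (\<phi> p) * dir_deriv b (f \<circ> inv_into U \<phi>) (\<phi> p))"
      using X U unfolding vector_field_op_def by fast
    define T where "T g x = (\<Sum>b\<in>E. \<Sum>vs\<in>L.
      (c b x * a vs x) * iter_dir_deriv (b # vs) g x
      + (c b x * dir_deriv b (a vs) x) * iter_dir_deriv vs g x)" for g x
    have "diff_form (Suc k) (\<phi> ` U) T"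
      unfolding T_def
    proof (rule diff_form_sum[OF op], rule diff_form_sum[OF op], rule diff_form_add[OF op])
      fix b vs assume b: "b \<in> E" and vs: "vs \<in> L"
      show "diff_form (Suc k) (\<phi> ` U) (\<lambda>g x. (c b x * a vs x) * iter_dir_deriv (b # vs) g x)"
        using L(1)[OF vs] by (intro diff_form_monomial smooth_on_mult op c(1) b L(2) vs) simp
      show "diff_form (Suc k) (\<phi> ` U) (\<lambda>g x. (c b x * dir_deriv b (a vs) x) * iter_dir_deriv vs g x)"
        using L(1)[OF vs]
        by (intro diff_form_monomial smooth_on_mult smooth_on_dir_deriv op c(1) b L(2) vs) simp
    qed
    moreover have "X (P f) p = T (f \<circ> inv_into U \<phi>) (\<phi> p)"
      if f: "f \<in> smooth_functions A" and p: "p \<in> U" for f p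
    proof -
      let ?g = "f \<circ> inv_into U \<phi>"
      have g: "smooth_on (\<phi> ` U) ?g" by (rule smooth_functionsD[OF f U])
      have Pf: "P f \<in> smooth_functions A" by (rule linear_diff_op_smooth[OF P f])
      have x: "\<phi> p \<in> \<phi> ` U" using p by simp
      have "dir_deriv b (P f \<circ> inv_into U \<phi>) (\<phi> p)
          = (\<Sum>vs\<in>L. a vs (\<phi> p) * iter_dir_deriv (b # vs) ?g (\<phi> p)
              + dir_deriv b (a vs) (\<phi> p) * iter_dir_deriv vs ?g (\<phi> p))" for b
      proof -
        have eq: "dir_deriv b (P f \<circ> inv_into U \<phi>) (\<phi> p)
            = dir_deriv b (\<lambda>x. \<Sum>vs\<in>L. a vs x * iter_dir_deriv vs ?g x) (\<phi> p)"
          by (rule dir_deriv_cong_open[OF op x]) (use La(3) f chart(6,7)[OF U] in auto)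
        have D: "((\<lambda>x. a vs x * iter_dir_deriv vs ?g x) has_derivative
            (\<lambda>b. a vs (\<phi> p) * dir_deriv b (iter_dir_deriv vs ?g) (\<phi> p)
              + dir_deriv b (a vs) (\<phi> p) * iter_dir_deriv vs ?g (\<phi> p))) (at (\<phi> p))" if "vs \<in> L" for vs
          by (intro bounded_bilinear.FDERIV[OF bounded_bilinear_mult] has_derivative_dir_deriv
              smooth_on_imp_differentiable[OF _ x] L(2)[OF that] smooth_on_iter_dir_deriv g)
        show ?thesis
          using eq dir_deriv_eq[OF has_derivative_sum[of L, OF D], where v = b] by simp
      qed
      then show ?thesis
        using c(2)[OF Pf p] unfolding T_def
        by (simp add: sum_distrib_left algebra_simps sum.distrib)
    qed
    ultimately show ?thesis by blast
  qed
  then show ?thesis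
    unfolding linear_diff_op_iff_diff_form by (intro exI[of _ "Suc k"]) auto
qed

definition cutoff_dir_deriv ::
    "'a set \<Rightarrow> ('a \<Rightarrow> 'e) \<Rightarrow> ('e \<Rightarrow> real) \<Rightarrow> 'e \<Rightarrow> ('a \<Rightarrow> 'k::real_normed_field) \<Rightarrow> 'a \<Rightarrow> 'k" where
  "cutoff_dir_deriv U \<phi> \<eta> v f p =
     (if p \<in> U then of_real (\<eta> (\<phi> p)) * dir_deriv v (f \<circ> inv_into U \<phi>) (\<phi> p) else 0)"

text \<open>In a second chart \<open>(V, \<psi>)\<close> the chain rule expresses the derivative through the frame
  derivatives, with the derivative of the coordinate change \<open>\<sigma>\<close> as coefficients. The coefficients
  are smooth near points of \<open>U\<close>. Away from the preimage of \<open>C\<close> they vanish, and that preimage is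
  closed because it is compact and the manifold is Hausdorff.\<close>

lemma vector_field_op_cutoff:
  fixes U \<phi> \<eta>
  assumes E: "parseval_frame E" and U: "(U, \<phi>) \<in> A" and C: "compact C" "C \<subseteq> \<phi> ` U"
    and \<eta>: "smooth_on UNIV \<eta>" "\<And>y. y \<notin> C \<Longrightarrow> \<eta> y = 0"
  shows "vector_field_op E (cutoff_dir_deriv U \<phi> \<eta> v
    :: ('a \<Rightarrow> 'k::real_normed_field) \<Rightarrow> 'a \<Rightarrow> 'k)"
  unfolding vector_field_op_def
proof (clarify)
  fix V \<psi> assume V: "(V, \<psi>) \<in> A"
  define \<sigma> where "\<sigma> = \<psi> \<circ> inv_into U \<phi>"
  define \<tau> where "\<tau> = \<phi> \<circ> inv_into V \<psi>"
  have sm: "smooth_on (\<phi> ` (U \<inter> V)) \<sigma>" "smooth_on (\<psi> ` (U \<inter> V)) \<tau>"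
    using transition_smooth[OF U V] transition_smooth[OF V U] by (simp_all add: \<sigma>_def \<tau>_def Int_commute)
  have op: "open (\<phi> ` (U \<inter> V))" "open (\<psi> ` (U \<inter> V))"
    using chart_image_open[OF U chart(1)[OF V]] chart_image_open[OF V chart(1)[OF U]]
    by (simp_all add: Int_commute)
  define h where "h b z = \<eta> z * (dir_deriv v \<sigma> z \<bullet> b)" for b z
  define c :: "'e \<Rightarrow> 'e \<Rightarrow> 'k" where
    "c b y = (if inv_into V \<psi> y \<in> U then of_real (h b (\<tau> y)) else 0)" for b y
  have "smooth_on (\<psi> ` V) (c b)" for b
  proof (rule smooth_on_local)
    fix y assume "y \<in> \<psi> ` V"
    then obtain q where q: "q \<in> V" "y = \<psi> q" by auto
    show "\<exists>T. open T \<and> y \<in> T \<and> smooth_on T (c b)"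
    proof (cases "q \<in> U")
      case True
      have "smooth_on (\<phi> ` (U \<inter> V)) (h b)"
        unfolding h_def
        by (intro smooth_on_mult smooth_on_inner smooth_on_dir_deriv smooth_on_const sm op
            smooth_on_subset[OF \<eta>(1)]) auto
      moreover have "\<tau> ` \<psi> ` (U \<inter> V) \<subseteq> \<phi> ` (U \<inter> V)" using chart(5)[OF V] by (auto simp: \<tau>_def)
      ultimately have "smooth_on (\<psi> ` (U \<inter> V)) (h b \<circ> \<tau>)"
        using smooth_on_compose[OF E op(2) _ _ sm(2)] by blast
      then have "smooth_on (\<psi> ` (U \<inter> V)) (\<lambda>y. of_real ((h b \<circ> \<tau>) y) :: 'k)"
        by (rule smooth_on_bounded_linear_compose[OF bounded_linear_of_real op(2)])
      then have "smooth_on (\<psi> ` (U \<inter> V)) (c b)"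
        by (rule smooth_on_cong[OF op(2), THEN iffD1, rotated])
          (use chart(5)[OF V] in \<open>auto simp: c_def\<close>)
      then show ?thesis using True q op(2) by blast
    next
      case False
      let ?Z = "inv_into U \<phi> ` C"
      have "closed ?Z" by (intro compact_imp_closed chart_preimage_compact[OF U C])
      then have opZ: "open (\<psi> ` (V \<inter> - ?Z))" by (intro chart_image_open[OF V]) auto
      have "?Z \<subseteq> U" using C(2) chart(6)[OF U] by blast
      then have "y \<in> \<psi> ` (V \<inter> - ?Z)" using False q by blast
      moreover have "c b z = 0" if z: "z \<in> \<psi> ` (V \<inter> - ?Z)" for z
      proof -
        obtain p where p: "p \<in> V" "p \<notin> ?Z" "z = \<psi> p" using z by blast
        then have "\<eta> (\<phi> p) = 0" if "p \<in> U"
          using \<eta>(2) chart(5)[OF U that] by (metis image_eqI)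
        then show ?thesis using p chart(5)[OF V] by (auto simp: c_def h_def \<tau>_def)
      qed
      then have "smooth_on (\<psi> ` (V \<inter> - ?Z)) (c b)"
        using smooth_on_cong[OF opZ, of "c b" "\<lambda>_. 0"] smooth_on_const by blast
      ultimately show ?thesis using opZ by blast
    qed
  qed
  moreover have "cutoff_dir_deriv U \<phi> \<eta> v f p
      = (\<Sum>b\<in>E. c b (\<psi> p) * dir_deriv b (f \<circ> inv_into V \<psi>) (\<psi> p))"
    if f: "f \<in> smooth_functions A" and p: "p \<in> V" for f :: "'a \<Rightarrow> 'k" and p
  proof (cases "p \<in> U")
    case True
    have x: "\<phi> p \<in> \<phi> ` (U \<inter> V)" using True p by blast
    have \<sigma>p: "\<sigma> (\<phi> p) = \<psi> p" using chart(5)[OF U True] by (simp add: \<sigma>_def)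
    have "dir_deriv v (f \<circ> inv_into U \<phi>) (\<phi> p) = dir_deriv v ((f \<circ> inv_into V \<psi>) \<circ> \<sigma>) (\<phi> p)"
      by (rule dir_deriv_cong_open[OF op(1) x])
        (use chart(5)[OF U] chart(5)[OF V] in \<open>auto simp: \<sigma>_def\<close>)
    also have "\<dots> = (\<Sum>b\<in>E. (dir_deriv v \<sigma> (\<phi> p) \<bullet> b) *\<^sub>R dir_deriv b (f \<circ> inv_into V \<psi>) (\<sigma> (\<phi> p)))"
      using p by (intro dir_deriv_compose E smooth_on_imp_differentiable[OF sm(1) x]
          smooth_on_imp_differentiable[OF smooth_functionsD[OF f V]]) (simp add: \<sigma>p)
    finally show ?thesis
      using True chart(5)[OF V p]
      by (simp add: cutoff_dir_deriv_def c_def h_def \<tau>_def \<sigma>p sum_distrib_left scaleR_conv_of_real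
          mult.assoc)
  next
    case False
    then show ?thesis using chart(5)[OF V p] by (simp add: cutoff_dir_deriv_def c_def)
  qed
  ultimately show "\<exists>c. (\<forall>b\<in>E. smooth_on (\<psi> ` V) (c b)) \<and>
     (\<forall>f\<in>smooth_functions A. \<forall>p\<in>V. cutoff_dir_deriv U \<phi> \<eta> v f p
        = (\<Sum>b\<in>E. (c b (\<psi> p) :: 'k) * dir_deriv b (f \<circ> inv_into V \<psi>) (\<psi> p)))"
    by blast
qed

text \<open>Composing cut-off derivatives gives a global operator. Where the cut-off function is \<open>1\<close>, each step
  acts as the plain coordinate derivative, since derivatives are local.\<close>

lemma linear_diff_op_extending_iter_dir_deriv:
  assumes U: "(U, \<phi>) \<in> A" and r: "r > 0" "cball x (2 * r) \<subseteq> \<phi> ` U"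
  obtains P :: "('a \<Rightarrow> 'k::real_normed_field) \<Rightarrow> 'a \<Rightarrow> 'k" where "linear_diff_op A P"
    "\<And>f p. f \<in> smooth_functions A \<Longrightarrow> p \<in> U \<Longrightarrow> \<phi> p \<in> ball x r \<Longrightarrow>
       P f p = iter_dir_deriv vs (f \<circ> inv_into U \<phi>) (\<phi> p)"
proof -
  obtain E :: "'e set" where E: "parseval_frame E" using frame_exists .
  obtain \<eta> :: "'e \<Rightarrow> real" where \<eta>: "smooth_on UNIV \<eta>"
    "\<And>y. y \<in> cball x r \<Longrightarrow> \<eta> y = 1" "\<And>y. y \<notin> cball x (2 * r) \<Longrightarrow> \<eta> y = 0"
    using cutoff_exists[OF r(1), of x] by metis
  have "\<exists>P :: ('a \<Rightarrow> 'k) \<Rightarrow> 'a \<Rightarrow> 'k. linear_diff_op A P \<and>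
      (\<forall>f\<in>smooth_functions A. \<forall>p\<in>U. \<phi> p \<in> ball x r \<longrightarrow>
         P f p = iter_dir_deriv vs (f \<circ> inv_into U \<phi>) (\<phi> p))"
  proof (induction vs)
    case Nil
    then show ?case
      using linear_diff_op_id chart(5)[OF U] by (intro exI[of _ "\<lambda>f. f"]) auto
  next
    case (Cons v vs)
    then obtain P :: "('a \<Rightarrow> 'k) \<Rightarrow> 'a \<Rightarrow> 'k" where P: "linear_diff_op A P"
      "\<And>f p. f \<in> smooth_functions A \<Longrightarrow> p \<in> U \<Longrightarrow> \<phi> p \<in> ball x r \<Longrightarrow>
         P f p = iter_dir_deriv vs (f \<circ> inv_into U \<phi>) (\<phi> p)" by blast
    let ?X = "cutoff_dir_deriv U \<phi> \<eta> v :: ('a \<Rightarrow> 'k) \<Rightarrow> 'a \<Rightarrow> 'k"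
    have "linear_diff_op A (\<lambda>f. ?X (P f))"
      by (rule linear_diff_op_vector_field_comp[OF P(1)
            vector_field_op_cutoff[OF E U compact_cball_frame[OF E] r(2) \<eta>(1,3)]])
    moreover have "?X (P f) p = iter_dir_deriv (v # vs) (f \<circ> inv_into U \<phi>) (\<phi> p)"
      if f: "f \<in> smooth_functions A" and p: "p \<in> U" "\<phi> p \<in> ball x r" for f p
    proof -
      have sub: "ball x r \<subseteq> \<phi> ` U" using r ball_subset_cball subset_ball[of r "2 * r" x] by fastforce
      have "dir_deriv v (P f \<circ> inv_into U \<phi>) (\<phi> p)
          = dir_deriv v (iter_dir_deriv vs (f \<circ> inv_into U \<phi>)) (\<phi> p)"
        by (rule dir_deriv_cong_open[OF open_ball p(2)])
          (use P(2)[OF f] sub chart(6,7)[OF U] in \<open>simp add: subset_iff\<close>)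
      then show ?thesis using p \<eta>(2)[of "\<phi> p"] by (simp add: cutoff_dir_deriv_def)
    qed
    ultimately show ?case by blast
  qed
  then show thesis using that by blast
qed

end

section \<open>Moderate and negligible nets in charts\<close>

lemma sup_on_le:
  assumes "\<And>p. p \<in> K \<Longrightarrow> norm (f p) \<le> M" "0 \<le> M"
  shows "\<bar>sup_on K f\<bar> \<le> M"
proof -
  let ?S = "insert 0 ((\<lambda>p. norm (f p)) ` K)"
  have "bdd_above ?S" using assms(1) by (auto intro!: bdd_aboveI)
  then have "0 \<le> Sup ?S" by (intro cSup_upper) auto
  moreover have "Sup ?S \<le> M" using assms by (intro cSup_least) auto
  ultimately show ?thesis by (simp add: sup_on_def)
qed

text \<open>The value of \<open>Sup\<close> on an unbounded set is meaningless; continuity on a compact set rules this out.\<close>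

lemma norm_le_sup_on:
  assumes "compact K" "continuous_on K f" "p \<in> K"
  shows "norm (f p) \<le> \<bar>sup_on K f\<bar>"
proof -
  have "bdd_above ((\<lambda>p. norm (f p)) ` K)"
    by (intro bounded_imp_bdd_above compact_imp_bounded compact_continuous_image assms
        continuous_on_norm)
  then have "norm (f p) \<le> sup_on K f"
    unfolding sup_on_def using assms(3) by (intro cSup_upper) auto
  then show ?thesis by simp
qed

lemma sup_on_bigo_imp:
  fixes F :: "real \<Rightarrow> 'a::topological_space \<Rightarrow> 'k::real_normed_field" and g :: "real \<Rightarrow> real"
  assumes "compact K" "\<And>\<epsilon>. \<epsilon> \<in> {0<..1} \<Longrightarrow> continuous_on K (F \<epsilon>)"
    and "(\<lambda>\<epsilon>. sup_on K (F \<epsilon>)) \<in> O[at_right 0](\<lambda>\<epsilon>. g \<epsilon>)"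
  obtains c where "c > 0" "\<forall>\<^sub>F \<epsilon> in at_right 0. \<forall>p\<in>K. norm (F \<epsilon> p) \<le> c * \<bar>g \<epsilon>\<bar>"
proof -
  obtain c where c: "c > 0" "\<forall>\<^sub>F \<epsilon> in at_right 0. norm (sup_on K (F \<epsilon>)) \<le> c * norm (g \<epsilon>)"
    using assms(3) by (elim landau_o.bigE)
  have "\<forall>\<^sub>F \<epsilon> in at_right 0. \<forall>p\<in>K. norm (F \<epsilon> p) \<le> c * \<bar>g \<epsilon>\<bar>"
    using c(2) eventually_at_right_0_Ioc
  proof eventually_elim
    case (elim \<epsilon>)
    then show ?case using norm_le_sup_on[OF assms(1) assms(2)[OF elim(2)]] by fastforce
  qed
  then show thesis using that c(1) by blast
qed

lemma sup_on_bigoI: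
  fixes F :: "real \<Rightarrow> 'a \<Rightarrow> 'k::real_normed_field" and g :: "real \<Rightarrow> real"
  assumes "\<forall>\<^sub>F \<epsilon> in at_right 0. \<forall>p\<in>K. norm (F \<epsilon> p) \<le> g \<epsilon>" "\<forall>\<^sub>F \<epsilon> in at_right 0. 0 \<le> g \<epsilon>"
  shows "(\<lambda>\<epsilon>. sup_on K (F \<epsilon>)) \<in> O[at_right 0](g)"
proof (rule landau_o.bigI[of 1])
  show "\<forall>\<^sub>F \<epsilon> in at_right 0. norm (sup_on K (F \<epsilon>)) \<le> 1 * norm (g \<epsilon>)"
    using assms by eventually_elim (simp add: sup_on_le)
qed simp

lemma tempered_on_iff_bigo:
  assumes "compact K" "\<And>\<epsilon>. \<epsilon> \<in> {0<..1} \<Longrightarrow> continuous_on K (F \<epsilon>)"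
  shows "(\<exists>N. (\<lambda>\<epsilon>. sup_on K (F \<epsilon>)) \<in> O[at_right 0](\<lambda>\<epsilon>. 1 / \<epsilon> ^ N)) \<longleftrightarrow> tempered_on K F"
proof
  assume "\<exists>N. (\<lambda>\<epsilon>. sup_on K (F \<epsilon>)) \<in> O[at_right 0](\<lambda>\<epsilon>. 1 / \<epsilon> ^ N)"
  then obtain N where N: "(\<lambda>\<epsilon>. sup_on K (F \<epsilon>)) \<in> O[at_right 0](\<lambda>\<epsilon>. 1 / \<epsilon> ^ N)" ..
  obtain c where "c > 0" "\<forall>\<^sub>F \<epsilon> in at_right 0. \<forall>p\<in>K. norm (F \<epsilon> p) \<le> c * \<bar>1 / \<epsilon> ^ N\<bar>"
    using sup_on_bigo_imp[OF assms N] .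
  from this(2) have "\<forall>\<^sub>F \<epsilon> in at_right 0. \<forall>p\<in>K. norm (F \<epsilon> p) \<le> c / \<epsilon> ^ N"
    using eventually_at_right_0_Ioc by eventually_elim simp
  then show "tempered_on K F" by (rule tempered_onI)
next
  assume "tempered_on K F"
  then obtain N where N: "\<forall>\<^sub>F \<epsilon> in at_right 0. \<forall>x\<in>K. norm (F \<epsilon> x) \<le> 1 / \<epsilon> ^ N"
    by (auto simp: tempered_on_def)
  then have "(\<lambda>\<epsilon>. sup_on K (F \<epsilon>)) \<in> O[at_right 0](\<lambda>\<epsilon>. 1 / \<epsilon> ^ N)"
    by (rule sup_on_bigoI) (use eventually_at_right_0_Ioc in \<open>eventually_elim, simp\<close>)
  then show "\<exists>N. (\<lambda>\<epsilon>. sup_on K (F \<epsilon>)) \<in> O[at_right 0](\<lambda>\<epsilon>. 1 / \<epsilon> ^ N)" ..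
qed

lemma rapid_on_iff_bigo:
  assumes "compact K" "\<And>\<epsilon>. \<epsilon> \<in> {0<..1} \<Longrightarrow> continuous_on K (F \<epsilon>)"
  shows "(\<forall>m. (\<lambda>\<epsilon>. sup_on K (F \<epsilon>)) \<in> O[at_right 0](\<lambda>\<epsilon>. \<epsilon> ^ m)) \<longleftrightarrow> rapid_on K F"
proof
  assume *: "\<forall>m. (\<lambda>\<epsilon>. sup_on K (F \<epsilon>)) \<in> O[at_right 0](\<lambda>\<epsilon>. \<epsilon> ^ m)"
  show "rapid_on K F"
    unfolding rapid_on_def
  proof
    fix m
    obtain c where c: "c > 0" "\<forall>\<^sub>F \<epsilon> in at_right 0. \<forall>p\<in>K. norm (F \<epsilon> p) \<le> c * \<bar>\<epsilon> ^ Suc m\<bar>"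
      using sup_on_bigo_imp[OF assms *[rule_format, of "Suc m"]] .
    have "\<forall>\<^sub>F \<epsilon> in at_right 0. 0 < \<epsilon> \<and> c * \<epsilon> < 1"
      using c(1) by (intro eventually_at_right_0I[of "1 / c"]) (auto simp: field_simps)
    with c(2) show "\<forall>\<^sub>F \<epsilon> in at_right 0. \<forall>x\<in>K. norm (F \<epsilon> x) \<le> \<epsilon> ^ m"
    proof eventually_elim
      case (elim \<epsilon>)
      have "c * \<epsilon> ^ Suc m \<le> \<epsilon> ^ m" using elim(2) mult_right_mono[of "c * \<epsilon>" 1 "\<epsilon> ^ m"] by simp
      moreover have "c * \<bar>\<epsilon> ^ Suc m\<bar> = c * \<epsilon> ^ Suc m" using elim(2) by simp
      ultimately show ?case using elim(1) order_trans by metis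
    qed
  qed
next
  assume "rapid_on K F"
  show "\<forall>m. (\<lambda>\<epsilon>. sup_on K (F \<epsilon>)) \<in> O[at_right 0](\<lambda>\<epsilon>. \<epsilon> ^ m)"
  proof
    fix m
    show "(\<lambda>\<epsilon>. sup_on K (F \<epsilon>)) \<in> O[at_right 0](\<lambda>\<epsilon>. \<epsilon> ^ m)"
      using \<open>rapid_on K F\<close> unfolding rapid_on_def
      by (intro sup_on_bigoI) (blast, use eventually_at_right_0_Ioc in \<open>eventually_elim, simp\<close>)
  qed
qed

text \<open>Moderateness speaks about global operators only. Near each point of \<open>C\<close> the chart derivative agrees
  with such an operator, on a compact ball, and compactness of \<open>C\<close> puts the local bounds together.\<close>

lemma (in smooth_manifold) moderate_imp_chart_tempered:
  fixes u :: "real \<Rightarrow> 'a \<Rightarrow> 'k::real_normed_field"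
  assumes u: "u \<in> moderate A" and U: "(U, \<phi>) \<in> A" and C: "compact C" "C \<subseteq> \<phi> ` U"
  shows "tempered_on C (\<lambda>\<epsilon>. iter_dir_deriv vs (u \<epsilon> \<circ> inv_into U \<phi>))"
proof (rule tempered_on_compactI[OF C(1)])
  fix x assume "x \<in> C"
  obtain E :: "'e set" where E: "parseval_frame E" using frame_exists .
  obtain s where s: "s > 0" "cball x s \<subseteq> \<phi> ` U"
    using \<open>x \<in> C\<close> C(2) chart(2)[OF U] unfolding open_contains_cball by blast
  \<comment> \<open>The cut-off function is \<open>1\<close> on \<open>cball x r\<close> and lives in \<open>cball x (2 * r)\<close>.\<close>
  define r where "r = s / 2"
  have r: "r > 0" "cball x (2 * r) \<subseteq> \<phi> ` U" using s by (auto simp: r_def)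
  obtain P :: "('a \<Rightarrow> 'k) \<Rightarrow> 'a \<Rightarrow> 'k" where P: "linear_diff_op A P"
    "\<And>f p. f \<in> smooth_functions A \<Longrightarrow> p \<in> U \<Longrightarrow> \<phi> p \<in> ball x r \<Longrightarrow>
       P f p = iter_dir_deriv vs (f \<circ> inv_into U \<phi>) (\<phi> p)"
    using linear_diff_op_extending_iter_dir_deriv[OF U r, of vs] by blast
  have u_smooth: "u \<epsilon> \<in> smooth_functions A" if "\<epsilon> \<in> {0<..1}" for \<epsilon>
    using u that by (auto simp: moderate_def)
  let ?D = "cball x (r / 2)"
  have D: "?D \<subseteq> ball x r" "?D \<subseteq> \<phi> ` U" using r by (auto simp: subset_iff)
  let ?K = "inv_into U \<phi> ` ?D"
  have K: "compact ?K" by (rule chart_preimage_compact[OF U compact_cball_frame[OF E] D(2)])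
  have "\<exists>N. (\<lambda>\<epsilon>. sup_on ?K (P (u \<epsilon>))) \<in> O[at_right 0](\<lambda>\<epsilon>. 1 / \<epsilon> ^ N)"
    using u K P(1) unfolding moderate_def by blast
  then have "tempered_on ?K (\<lambda>\<epsilon>. P (u \<epsilon>))"
    using tempered_on_iff_bigo[OF K, of "\<lambda>\<epsilon>. P (u \<epsilon>)"]
      smooth_functions_continuous_on[OF linear_diff_op_smooth[OF P(1) u_smooth]] by blast
  then obtain N where N: "\<forall>\<^sub>F \<epsilon> in at_right 0. \<forall>p\<in>?K. norm (P (u \<epsilon>) p) \<le> 1 / \<epsilon> ^ N"
    by (auto simp: tempered_on_def)
  have "\<forall>\<^sub>F \<epsilon> in at_right 0. \<forall>y\<in>C \<inter> ball x (r / 2).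
      norm (iter_dir_deriv vs (u \<epsilon> \<circ> inv_into U \<phi>) y) \<le> 1 / \<epsilon> ^ N"
    using N eventually_at_right_0_Ioc
  proof eventually_elim
    case (elim \<epsilon>)
    show ?case
    proof
      fix y assume y: "y \<in> C \<inter> ball x (r / 2)"
      then have "y \<in> ?D" by auto
      then have "y \<in> ?D" "y \<in> \<phi> ` U" "y \<in> ball x r" using D by blast+
      then have "P (u \<epsilon>) (inv_into U \<phi> y) = iter_dir_deriv vs (u \<epsilon> \<circ> inv_into U \<phi>) y"
        using P(2)[OF u_smooth[OF elim(2)], of "inv_into U \<phi> y"] chart(6,7)[OF U] by simp
      moreover have "inv_into U \<phi> y \<in> ?K" using \<open>y \<in> ?D\<close> by blast
      ultimately show "norm (iter_dir_deriv vs (u \<epsilon> \<circ> inv_into U \<phi>) y) \<le> 1 / \<epsilon> ^ N"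
        using elim(1) by metis
    qed
  qed
  then show "\<exists>T. open T \<and> x \<in> T \<and> tempered_on (C \<inter> T) (\<lambda>\<epsilon>. iter_dir_deriv vs (u \<epsilon> \<circ> inv_into U \<phi>))"
    using r by (intro exI[of _ "ball x (r / 2)"]) (auto simp: tempered_on_def)
qed

text \<open>Near each point the operator is a finite sum of chart derivatives whose coefficients, being
  continuous, are bounded on a compact ball.\<close>

lemma (in smooth_manifold) chart_tempered_imp_tempered_op:
  fixes u :: "real \<Rightarrow> 'a \<Rightarrow> 'k::real_normed_field"
  assumes smooth: "\<And>\<epsilon>. \<epsilon> \<in> {0<..1} \<Longrightarrow> u \<epsilon> \<in> smooth_functions A"
    and temp: "\<And>U \<phi> C vs. (U, \<phi>) \<in> A \<Longrightarrow> compact C \<Longrightarrow> C \<subseteq> \<phi> ` U \<Longrightarrow>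
      tempered_on C (\<lambda>\<epsilon>. iter_dir_deriv vs (u \<epsilon> \<circ> inv_into U \<phi>))"
    and P: "linear_diff_op A P" and K: "compact K"
  shows "tempered_on K (\<lambda>\<epsilon>. P (u \<epsilon>))"
proof (rule tempered_on_compactI[OF K])
  fix p assume "p \<in> K"
  obtain U \<phi> where U: "(U, \<phi>) \<in> A" "p \<in> U" using chart_cover .
  obtain E :: "'e set" where E: "parseval_frame E" using frame_exists .
  obtain s where s: "s > 0" "cball (\<phi> p) s \<subseteq> \<phi> ` U"
    using U(2) chart(2)[OF U(1)] unfolding open_contains_cball by blast
  let ?C = "cball (\<phi> p) s" and ?T = "\<phi> -` ball (\<phi> p) s \<inter> U"
  have C: "compact ?C" by (rule compact_cball_frame[OF E])
  have "open ?T"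
    using continuous_on_open_vimage[OF chart(1)[OF U(1)]] chart(3)[OF U(1)] open_ball by blast
  moreover have "p \<in> ?T" using U s by simp
  moreover have "tempered_on ?T (\<lambda>\<epsilon>. P (u \<epsilon>))"
  proof -
    obtain L a where L: "finite L" "\<And>vs. vs \<in> L \<Longrightarrow> smooth_on (\<phi> ` U) (a vs)"
      "\<And>f p. f \<in> smooth_functions A \<Longrightarrow> p \<in> U \<Longrightarrow>
         P f p = (\<Sum>vs\<in>L. a vs (\<phi> p) * iter_dir_deriv vs (f \<circ> inv_into U \<phi>) (\<phi> p))"
      using linear_diff_op_chartE[OF P U(1)] by blast
    have "tempered_on ?C (\<lambda>\<epsilon> x. \<Sum>vs\<in>L. a vs x * iter_dir_deriv vs (u \<epsilon> \<circ> inv_into U \<phi>) x)"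
      by (intro tempered_on_sum bounded_bilinear.tempered_on_bilinear[OF bounded_bilinear_mult]
          temp[OF U(1) C s(2)] tempered_on_const_continuous C
          smooth_on_imp_continuous_on smooth_on_subset[OF L(2) s(2)])
    then have "tempered_on ?T
        (\<lambda>\<epsilon> q. \<Sum>vs\<in>L. a vs (\<phi> q) * iter_dir_deriv vs (u \<epsilon> \<circ> inv_into U \<phi>) (\<phi> q))"
      by (rule tempered_on_comp) (auto intro: less_imp_le)
    then show ?thesis
      by (rule tempered_on_cong[THEN iffD1, rotated]) (simp add: L(3)[OF smooth])
  qed
  ultimately show "\<exists>T. open T \<and> p \<in> T \<and> tempered_on (K \<inter> T) (\<lambda>\<epsilon>. P (u \<epsilon>))"
    using tempered_on_subset[of ?T _ "K \<inter> ?T"] by blast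
qed

text \<open>This characterization replaces all differential operators by iterated derivatives in charts. It is
  what makes products and inverses of moderate nets accessible.\<close>

proposition (in smooth_manifold) moderate_iff_smooth_tempered:
  fixes u :: "real \<Rightarrow> 'a \<Rightarrow> 'k::real_normed_field"
  shows "u \<in> moderate A \<longleftrightarrow> u \<in> {0<..1} \<rightarrow>\<^sub>E smooth_functions A \<and>
    (\<forall>(U, \<phi>)\<in>A. smooth_tempered (\<phi> ` U) (\<lambda>\<epsilon>. u \<epsilon> \<circ> inv_into U \<phi>))"
proof (intro iffI conjI)
  assume u: "u \<in> moderate A"
  then show PiE: "u \<in> {0<..1} \<rightarrow>\<^sub>E smooth_functions A" by (simp add: moderate_def)
  show "\<forall>(U, \<phi>)\<in>A. smooth_tempered (\<phi> ` U) (\<lambda>\<epsilon>. u \<epsilon> \<circ> inv_into U \<phi>)"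
    using smooth_functionsD[OF PiE_mem[OF PiE]] moderate_imp_chart_tempered[OF u]
    unfolding smooth_tempered_def Ck_tempered_iff_iter_dir_deriv by blast
next
  assume *: "u \<in> {0<..1} \<rightarrow>\<^sub>E smooth_functions A \<and>
    (\<forall>(U, \<phi>)\<in>A. smooth_tempered (\<phi> ` U) (\<lambda>\<epsilon>. u \<epsilon> \<circ> inv_into U \<phi>))"
  then have smooth: "u \<epsilon> \<in> smooth_functions A" if "\<epsilon> \<in> {0<..1}" for \<epsilon> using that by auto
  have temp: "tempered_on C (\<lambda>\<epsilon>. iter_dir_deriv vs (u \<epsilon> \<circ> inv_into U \<phi>))"
    if "(U, \<phi>) \<in> A" "compact C" "C \<subseteq> \<phi> ` U" for U \<phi> C vs
    using * that unfolding smooth_tempered_def Ck_tempered_iff_iter_dir_deriv by fast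
  have "\<exists>N. (\<lambda>\<epsilon>. sup_on K (P (u \<epsilon>))) \<in> O[at_right 0](\<lambda>\<epsilon>. 1 / \<epsilon> ^ N)"
    if K: "compact K" and P: "linear_diff_op A P" for K and P :: "('a \<Rightarrow> 'k) \<Rightarrow> 'a \<Rightarrow> 'k"
    using tempered_on_iff_bigo[OF K, of "\<lambda>\<epsilon>. P (u \<epsilon>)"]
      smooth_functions_continuous_on[OF linear_diff_op_smooth[OF P smooth]]
      chart_tempered_imp_tempered_op[OF smooth temp P K] by blast
  then show "u \<in> moderate A" using * unfolding moderate_def by blast
qed

lemma (in smooth_manifold) moderate_smooth:
  assumes "u \<in> moderate A" "\<epsilon> \<in> {0<..1}"
  shows "u \<epsilon> \<in> smooth_functions A"
  using assms by (auto simp: moderate_def)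

lemma (in smooth_manifold) moderate_imp_tempered_on:
  assumes "u \<in> moderate A" "compact K"
  shows "tempered_on K u"
  by (rule chart_tempered_imp_tempered_op[OF moderate_smooth[OF assms(1)]
        moderate_imp_chart_tempered[OF assms(1)] linear_diff_op_id assms(2)])

lemma (in smooth_manifold) negligible_nets_iff_rapid:
  "u \<in> negligible_nets A \<longleftrightarrow> u \<in> moderate A \<and> (\<forall>K. compact K \<longrightarrow> rapid_on K u)"
proof -
  have "(\<forall>m. (\<lambda>\<epsilon>. sup_on K (u \<epsilon>)) \<in> O[at_right 0](\<lambda>\<epsilon>. \<epsilon> ^ m)) \<longleftrightarrow> rapid_on K u"
    if "u \<in> moderate A" "compact K" for K
    using smooth_functions_continuous_on[OF moderate_smooth[OF that(1)]]
    by (intro rapid_on_iff_bigo[OF that(2)])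
  then show ?thesis unfolding negligible_nets_def by blast
qed

section \<open>The ring of moderate nets\<close>

lemma smooth_tempered_cong:
  assumes "open S" "\<And>\<epsilon> x. \<epsilon> \<in> {0<..1} \<Longrightarrow> x \<in> S \<Longrightarrow> F \<epsilon> x = G \<epsilon> x" "smooth_tempered S F"
  shows "smooth_tempered S G"
proof -
  have "smooth_on S (F \<epsilon>) \<longleftrightarrow> smooth_on S (G \<epsilon>)" if "\<epsilon> \<in> {0<..1}" for \<epsilon>
    by (rule smooth_on_cong[OF assms(1)]) (rule assms(2)[OF that])
  moreover have "Ck_tempered k S F \<longleftrightarrow> Ck_tempered k S G" for k
    by (rule Ck_tempered_cong[OF assms(1)]) (rule assms(2))
  ultimately show ?thesis using assms(3) by (simp add: smooth_tempered_def)
qed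

lemma smooth_tempered_add:
  assumes "open S" "smooth_tempered S F" "smooth_tempered S G"
  shows "smooth_tempered S (\<lambda>\<epsilon> x. F \<epsilon> x + G \<epsilon> x)"
  using assms by (auto simp: smooth_tempered_def intro: smooth_on_add Ck_tempered_add)

lemma smooth_tempered_mult:
  fixes F G :: "real \<Rightarrow> 'e::real_normed_vector \<Rightarrow> 'k::real_normed_field"
  assumes "open S" "smooth_tempered S F" "smooth_tempered S G"
  shows "smooth_tempered S (\<lambda>\<epsilon> x. F \<epsilon> x * G \<epsilon> x)"
  using assms
  by (auto simp: smooth_tempered_def
      intro: smooth_on_mult bounded_bilinear.Ck_tempered_bilinear[OF bounded_bilinear_mult])

lemma smooth_tempered_const:
  assumes "\<And>\<epsilon>. \<epsilon> \<in> {0<..1} \<Longrightarrow> norm (c \<epsilon>) \<le> M"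
  shows "smooth_tempered (S :: 'e::real_normed_vector set) (\<lambda>\<epsilon> x. c \<epsilon>)"
proof -
  have "tempered_on (UNIV :: 'e set) (\<lambda>\<epsilon> x. c \<epsilon>)"
    by (rule tempered_onI[of _ _ M 0], rule eventually_mono[OF eventually_at_right_0_Ioc])
      (use assms in auto)
  then show ?thesis by (auto simp: smooth_tempered_def smooth_on_const Ck_tempered_const)
qed

lemma smooth_tempered_bounded_linear:
  assumes "bounded_linear h" "open S" "smooth_tempered S F"
  shows "smooth_tempered S (\<lambda>\<epsilon> x. h (F \<epsilon> x))"
proof -
  interpret bounded_bilinear "\<lambda>(c::real) y. c *\<^sub>R h y"
    using bounded_bilinear.comp[OF bounded_bilinear_scaleR bounded_linear_ident assms(1)] .
  have "smooth_tempered S (\<lambda>\<epsilon> x. 1 :: real)" by (rule smooth_tempered_const[of _ 1]) simp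
  then have "Ck_tempered k S (\<lambda>\<epsilon> x. 1 *\<^sub>R h (F \<epsilon> x))" for k
    using assms unfolding smooth_tempered_def by (intro Ck_tempered_bilinear) auto
  then show ?thesis
    using assms(3) by (simp add: smooth_tempered_def smooth_on_bounded_linear_compose[OF assms(1,2)])
qed

lemma smooth_tempered_inverse:
  fixes F :: "real \<Rightarrow> 'e::real_normed_vector \<Rightarrow> 'k::real_normed_field"
  assumes "open S" "smooth_tempered S F" "\<And>\<epsilon> x. \<epsilon> \<in> {0<..1} \<Longrightarrow> x \<in> S \<Longrightarrow> F \<epsilon> x \<noteq> 0"
    and "\<And>C. compact C \<Longrightarrow> C \<subseteq> S \<Longrightarrow> tempered_on C (\<lambda>\<epsilon> x. inverse (F \<epsilon> x))"
  shows "smooth_tempered S (\<lambda>\<epsilon> x. inverse (F \<epsilon> x))"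
proof -
  have F: "smooth_on S (F \<epsilon>)" if "\<epsilon> \<in> {0<..1}" for \<epsilon>
    using assms(2) that by (auto simp: smooth_tempered_def)
  have FC: "Ck_tempered k S F" for k using assms(2) by (simp add: smooth_tempered_def)
  have "Ck_tempered k S (\<lambda>\<epsilon> x. inverse (F \<epsilon> x))" for k
    by (rule Ck_tempered_inverse[OF assms(1) F assms(3) FC]) (simp_all add: assms(4))
  moreover have "smooth_on S (\<lambda>x. inverse (F \<epsilon> x))" if "\<epsilon> \<in> {0<..1}" for \<epsilon>
    by (rule smooth_on_inverse[OF assms(1) F[OF that] assms(3)[OF that]])
  ultimately show ?thesis by (simp add: smooth_tempered_def)
qed

context smooth_manifold
begin

lemma moderateI:
  fixes F :: "real \<Rightarrow> 'a \<Rightarrow> 'k::real_normed_field"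
  assumes "\<And>U \<phi>. (U, \<phi>) \<in> A \<Longrightarrow> smooth_tempered (\<phi> ` U) (\<lambda>\<epsilon> x. F \<epsilon> (inv_into U \<phi> x))"
  shows "(\<lambda>\<epsilon>\<in>{0<..1}. F \<epsilon>) \<in> moderate A"
  unfolding moderate_iff_smooth_tempered
proof (intro conjI)
  have "F \<epsilon> \<in> smooth_functions A" if "\<epsilon> \<in> {0<..1}" for \<epsilon>
    using assms that by (intro smooth_functionsI) (auto simp: smooth_tempered_def o_def)
  then show "(\<lambda>\<epsilon>\<in>{0<..1}. F \<epsilon>) \<in> {0<..1} \<rightarrow>\<^sub>E smooth_functions A" by auto
next
  have "smooth_tempered (\<phi> ` U) (\<lambda>\<epsilon>. (\<lambda>\<epsilon>\<in>{0<..1}. F \<epsilon>) \<epsilon> \<circ> inv_into U \<phi>)"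
    if U: "(U, \<phi>) \<in> A" for U \<phi>
    by (rule smooth_tempered_cong[OF chart(2)[OF U] _ assms[OF U]]) simp
  then show "\<forall>(U, \<phi>)\<in>A. smooth_tempered (\<phi> ` U)
      (\<lambda>\<epsilon>. (\<lambda>\<epsilon>\<in>{0<..1}. F \<epsilon>) \<epsilon> \<circ> inv_into U \<phi>)" by blast
qed

lemma moderate_imp_smooth_tempered:
  assumes "u \<in> moderate A" "(U, \<phi>) \<in> A"
  shows "smooth_tempered (\<phi> ` U) (\<lambda>\<epsilon> x. u \<epsilon> (inv_into U \<phi> x))"
  using assms by (auto simp: moderate_iff_smooth_tempered o_def)

lemma moderate_eqI:
  assumes "u \<in> moderate A" "v \<in> moderate A" "\<And>\<epsilon> p. \<epsilon> \<in> {0<..1} \<Longrightarrow> u \<epsilon> p = v \<epsilon> p"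
  shows "u = v"
  using assms(1,2) unfolding moderate_def
  by (intro PiE_ext[of _ "{0<..1}" "\<lambda>_. smooth_functions A"]) (auto intro!: ext assms(3))

lemma moderate_ring_simps:
  "carrier (moderate_ring A) = moderate A"
  "\<zero>\<^bsub>moderate_ring A\<^esub> = (\<lambda>\<epsilon>\<in>{0<..1}. \<lambda>p. 0)"
  "\<one>\<^bsub>moderate_ring A\<^esub> = (\<lambda>\<epsilon>\<in>{0<..1}. \<lambda>p. 1)"
  "u \<oplus>\<^bsub>moderate_ring A\<^esub> v = (\<lambda>\<epsilon>\<in>{0<..1}. \<lambda>p. u \<epsilon> p + v \<epsilon> p)"
  "u \<otimes>\<^bsub>moderate_ring A\<^esub> v = (\<lambda>\<epsilon>\<in>{0<..1}. \<lambda>p. u \<epsilon> p * v \<epsilon> p)"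
  by (simp_all add: moderate_ring_def)

lemma moderate_const: "(\<lambda>\<epsilon>\<in>{0<..1}. \<lambda>p. c) \<in> moderate A"
  by (intro moderateI smooth_tempered_const[of _ "norm c"]) simp

lemma moderate_add:
  "u \<in> moderate A \<Longrightarrow> v \<in> moderate A \<Longrightarrow> (\<lambda>\<epsilon>\<in>{0<..1}. \<lambda>p. u \<epsilon> p + v \<epsilon> p) \<in> moderate A"
  by (intro moderateI smooth_tempered_add moderate_imp_smooth_tempered chart(2))

lemma moderate_mult:
  "u \<in> moderate A \<Longrightarrow> v \<in> moderate A \<Longrightarrow> (\<lambda>\<epsilon>\<in>{0<..1}. \<lambda>p. u \<epsilon> p * v \<epsilon> p) \<in> moderate A"
  by (intro moderateI smooth_tempered_mult moderate_imp_smooth_tempered chart(2))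

text \<open>The pointwise identities only have to be checked for \<open>\<epsilon> \<in> {0<..1}\<close>, since nets are extensional.\<close>

lemma cring_moderate_ring: "cring (moderate_ring A :: ('a, 'k::real_normed_field) net ring)"
proof (rule cringI)
  show "abelian_group (moderate_ring A :: ('a, 'k) net ring)"
  proof (rule abelian_groupI, unfold moderate_ring_simps)
    fix u :: "('a, 'k) net" assume u: "u \<in> moderate A"
    show "\<exists>v\<in>moderate A. (\<lambda>\<epsilon>\<in>{0<..1}. \<lambda>p. v \<epsilon> p + u \<epsilon> p) = (\<lambda>\<epsilon>\<in>{0<..1}. \<lambda>p. 0)"
      by (rule bexI[OF _ moderate_mult[OF moderate_const[of "- 1"] u]])
        (auto intro!: restrict_ext)
    show "(\<lambda>\<epsilon>\<in>{0<..1}. \<lambda>p. (\<lambda>\<epsilon>\<in>{0<..1}. \<lambda>p. 0) \<epsilon> p + u \<epsilon> p) = u"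
      by (rule moderate_eqI[OF moderate_add[OF moderate_const u] u]) simp
  qed (auto simp: moderate_add moderate_const algebra_simps intro!: restrict_ext)
  show "comm_monoid (moderate_ring A :: ('a, 'k) net ring)"
  proof (rule comm_monoidI, unfold moderate_ring_simps)
    fix u :: "('a, 'k) net" assume u: "u \<in> moderate A"
    show "(\<lambda>\<epsilon>\<in>{0<..1}. \<lambda>p. (\<lambda>\<epsilon>\<in>{0<..1}. \<lambda>p. 1) \<epsilon> p * u \<epsilon> p) = u"
      by (rule moderate_eqI[OF moderate_mult[OF moderate_const u] u]) simp
  qed (auto simp: moderate_mult moderate_const algebra_simps intro!: restrict_ext)
qed (auto simp: moderate_ring_simps algebra_simps intro!: restrict_ext)

lemma rapid_on_restrict:
  "rapid_on K (\<lambda>\<epsilon>\<in>{0<..1}. F \<epsilon>) \<longleftrightarrow> rapid_on K F"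
proof -
  have "eventually (\<lambda>\<epsilon>. \<forall>x\<in>K. norm ((\<lambda>\<epsilon>\<in>{0<..1}. F \<epsilon>) \<epsilon> x) \<le> \<epsilon> ^ m) (at_right 0) \<longleftrightarrow>
      eventually (\<lambda>\<epsilon>. \<forall>x\<in>K. norm (F \<epsilon> x) \<le> \<epsilon> ^ m) (at_right 0)" for m
    by (rule eventually_cong[OF eventually_at_right_0_Ioc]) simp
  then show ?thesis by (simp add: rapid_on_def)
qed

text \<open>A moderate net grows like a fixed power of \<open>1 / \<epsilon>\<close> on each compact set, and a negligible net
  absorbs every such power.\<close>

lemma negligible_ideal:
  "ideal (negligible_nets A) (moderate_ring A :: ('a, 'k::real_normed_field) net ring)"
proof -
  interpret cring "moderate_ring A :: ('a, 'k) net ring" by (rule cring_moderate_ring)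
  let ?R = "moderate_ring A :: ('a, 'k) net ring" and ?N = "negligible_nets A :: ('a, 'k) net set"
  have sub: "?N \<subseteq> carrier ?R" by (auto simp: negligible_nets_def moderate_ring_simps)
  have mult: "x \<otimes>\<^bsub>?R\<^esub> n \<in> ?N" if "x \<in> carrier ?R" "n \<in> ?N" for x n
    using that by (auto simp: negligible_nets_iff_rapid moderate_ring_simps rapid_on_restrict moderate_mult
        intro!: tempered_rapid_mult moderate_imp_tempered_on)
  have mult': "n \<otimes>\<^bsub>?R\<^esub> x \<in> ?N" if "n \<in> ?N" "x \<in> carrier ?R" for x n
    using mult[of x n] m_comm[of n x] that sub by auto
  have add: "n \<oplus>\<^bsub>?R\<^esub> n' \<in> ?N" if "n \<in> ?N" "n' \<in> ?N" for n n'
    using that by (auto simp: negligible_nets_iff_rapid moderate_ring_simps rapid_on_restrict moderate_add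
        intro!: rapid_on_add)
  have neg: "\<ominus>\<^bsub>?R\<^esub> n \<in> ?N" if "n \<in> ?N" for n
    using mult[of "\<ominus>\<^bsub>?R\<^esub> \<one>\<^bsub>?R\<^esub>" n] that sub by (auto simp: l_minus)
  have "\<zero>\<^bsub>?R\<^esub> \<in> ?N"
    by (auto simp: negligible_nets_iff_rapid moderate_ring_simps moderate_const rapid_on_restrict)
      (auto simp: rapid_on_def intro: eventually_mono[OF eventually_at_right_0_Ioc])
  then have "subgroup ?N (add_monoid ?R)"
    using sub add neg by (intro add.subgroupI) (auto simp: a_inv_def)
  then show ?thesis
    using mult mult' by (intro idealI ring_axioms)
qed

section \<open>Invertibility in the Colombeau algebra\<close>

text \<open>The condition on representatives in the characterization, without the detour over extended reals.\<close>

definition bounded_below_net :: "('a, 'k::real_normed_field) net \<Rightarrow> bool" where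
  "bounded_below_net w \<longleftrightarrow> (\<forall>K. compact K \<longrightarrow>
     (\<exists>q::nat. \<forall>\<^sub>F \<epsilon> in at_right 0. \<forall>p\<in>K. \<epsilon> ^ q \<le> norm (w \<epsilon> p)))"

lemma bounded_below_net_iff_INF:
  "bounded_below_net w \<longleftrightarrow> (\<forall>K. compact K \<longrightarrow> (\<exists>\<epsilon>\<^sub>0>0. \<exists>q::nat. \<forall>\<epsilon>\<in>{0<..1}. \<epsilon> < \<epsilon>\<^sub>0 \<longrightarrow>
     (INF p\<in>K. ereal (norm (w \<epsilon> p))) \<ge> ereal (\<epsilon> ^ q)))"
proof -
  have "(\<exists>q::nat. \<forall>\<^sub>F \<epsilon> in at_right 0. \<forall>p\<in>K. \<epsilon> ^ q \<le> norm (w \<epsilon> p)) \<longleftrightarrow>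
      (\<exists>\<epsilon>\<^sub>0>0. \<exists>q::nat. \<forall>\<epsilon>\<in>{0<..1}. \<epsilon> < \<epsilon>\<^sub>0 \<longrightarrow>
        (INF p\<in>K. ereal (norm (w \<epsilon> p))) \<ge> ereal (\<epsilon> ^ q))" (is "?L \<longleftrightarrow> ?R") for K
  proof
    assume ?L
    then obtain q d where "d > 0" "\<And>\<epsilon>. 0 < \<epsilon> \<Longrightarrow> \<epsilon> < d \<Longrightarrow> \<forall>p\<in>K. \<epsilon> ^ q \<le> norm (w \<epsilon> p)"
      by (auto simp: eventually_at_right_field)
    then show ?R by (intro exI[of _ d] conjI exI[of _ q]) (auto simp: le_INF_iff)
  next
    assume ?R
    then obtain d q where d: "d > 0" "\<forall>\<epsilon>\<in>{0<..1}. \<epsilon> < d \<longrightarrow> (\<forall>p\<in>K. \<epsilon> ^ q \<le> norm (w \<epsilon> p))"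
      unfolding le_INF_iff ereal_less_eq by blast
    have "\<forall>\<^sub>F \<epsilon> in at_right 0. \<forall>p\<in>K. \<epsilon> ^ q \<le> norm (w \<epsilon> p)"
      using d by (intro eventually_at_right_0I[of "min d 1"]) auto
    then show ?L ..
  qed
  then show ?thesis by (simp add: bounded_below_net_def)
qed

text \<open>If \<open>w z = 1 + n\<close> with \<open>n\<close> small, then \<open>|w| \<ge> (1 - \<epsilon>) / |z|\<close>, and \<open>|z|\<close> is at most a power of
  \<open>1 / \<epsilon>\<close>.\<close>

lemma unit_imp_bounded_below_net:
  fixes w z n :: "('a, 'k::real_normed_field) net"
  assumes "z \<in> moderate A" "n \<in> negligible_nets A"
    and wz: "\<And>\<epsilon> p. \<epsilon> \<in> {0<..1} \<Longrightarrow> w \<epsilon> p * z \<epsilon> p = n \<epsilon> p + 1"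
  shows "bounded_below_net w"
  unfolding bounded_below_net_def
proof (intro allI impI)
  fix K :: "'a set" assume K: "compact K"
  obtain N where N: "\<forall>\<^sub>F \<epsilon> in at_right 0. \<forall>p\<in>K. norm (z \<epsilon> p) \<le> 1 / \<epsilon> ^ N"
    using moderate_imp_tempered_on[OF assms(1) K] by (auto simp: tempered_on_def)
  have "rapid_on K n" using assms(2) K by (auto simp: negligible_nets_iff_rapid)
  then have n: "\<forall>\<^sub>F \<epsilon> in at_right 0. \<forall>p\<in>K. norm (n \<epsilon> p) \<le> \<epsilon> ^ 1" unfolding rapid_on_def by blast
  \<comment> \<open>For \<open>\<epsilon> < 1 / 2\<close> one has \<open>\<epsilon> \<le> 1 - \<epsilon>\<close>, which costs one more power of \<open>\<epsilon>\<close>.\<close>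
  have "\<forall>\<^sub>F \<epsilon> in at_right 0. \<epsilon> \<in> {0<..<1 / 2 :: real}"
    by (rule eventually_at_right_0I[of "1 / 2"]) auto
  with N n have "\<forall>\<^sub>F \<epsilon> in at_right 0. \<forall>p\<in>K. \<epsilon> ^ Suc N \<le> norm (w \<epsilon> p)"
  proof eventually_elim
    case (elim \<epsilon>)
    show ?case
    proof
      fix p assume p: "p \<in> K"
      have "1 - norm (n \<epsilon> p) \<le> norm (n \<epsilon> p + 1)"
        using norm_triangle_ineq2[of 1 "- n \<epsilon> p"] by (simp add: add.commute)
      also have "\<dots> = norm (w \<epsilon> p) * norm (z \<epsilon> p)"
        using wz[of \<epsilon> p] elim(3) by (simp add: norm_mult[symmetric])
      also have "\<dots> \<le> norm (w \<epsilon> p) * (1 / \<epsilon> ^ N)"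
        using elim(1) p by (intro mult_left_mono) auto
      finally have "1 - norm (n \<epsilon> p) \<le> norm (w \<epsilon> p) * (1 / \<epsilon> ^ N)" .
      moreover have "norm (n \<epsilon> p) \<le> \<epsilon>" using elim(2) p by simp
      ultimately have "\<epsilon> \<le> norm (w \<epsilon> p) / \<epsilon> ^ N" using elim(3) by simp
      then show "\<epsilon> ^ Suc N \<le> norm (w \<epsilon> p)" using elim(3) by (simp add: pos_le_divide_eq)
    qed
  qed
  then show "\<exists>q. \<forall>\<^sub>F \<epsilon> in at_right 0. \<forall>p\<in>K. \<epsilon> ^ q \<le> norm (w \<epsilon> p)" ..
qed

lemma flat_0_le_1: "flat 0 \<epsilon> \<le> 1"
  by (simp add: flat_def)

lemma rapid_on_flat: "rapid_on K (\<lambda>\<epsilon> p. of_real (flat 0 \<epsilon>) :: 'k::real_normed_field)"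
  unfolding rapid_on_def
proof
  fix m
  have "(flat m \<longlongrightarrow> 0) (at_right 0)"
    using flat_tendsto_0 by (rule filterlim_mono) (auto simp: at_within_le_at)
  then have "\<forall>\<^sub>F \<epsilon> in at_right 0. flat m \<epsilon> < 1" by (rule order_tendstoD) simp
  then show "\<forall>\<^sub>F \<epsilon> in at_right 0. \<forall>p\<in>K. norm (of_real (flat 0 \<epsilon>) :: 'k) \<le> \<epsilon> ^ m"
    using eventually_at_right_0_Ioc
  proof eventually_elim
    case (elim \<epsilon>)
    have "flat 0 \<epsilon> = \<epsilon> ^ m * flat m \<epsilon>"
      using elim(2) by (simp add: flat_def power_inverse)
    also have "\<dots> \<le> \<epsilon> ^ m * 1" using elim by (intro mult_left_mono) auto
    finally show ?case using flat_nonneg[of 0 \<epsilon>] by simp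
  qed
qed

text \<open>The inverse is \<open>cj w / (|w|\<^sup>2 + exp (- 1 / \<epsilon>))\<close>, where the exponential is \<open>flat 0 \<epsilon>\<close>. The added term
  keeps the denominator positive at every point and for every \<open>\<epsilon>\<close>, also where the lower bound on
  \<open>|w|\<close> fails, so this is a global smooth net. On a compact set the lower bound makes the inverse of
  the denominator tempered, and the error \<open>n\<close> that the added term causes is rapidly decreasing. For
  real values \<open>cj\<close> is the identity, for complex values it is the conjugation.\<close>

lemma bounded_below_net_imp_unit:
  fixes w :: "('a, 'k::real_normed_field) net"
  assumes cj: "bounded_linear cj" "\<And>z :: 'k. z * cj z = of_real ((norm z)\<^sup>2)"
    and w: "w \<in> moderate A" and inv: "bounded_below_net w"
  obtains v n where "v \<in> moderate A" "n \<in> negligible_nets A"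
    "\<And>\<epsilon> p. \<epsilon> \<in> {0<..1} \<Longrightarrow> w \<epsilon> p * v \<epsilon> p = n \<epsilon> p + 1"
proof -
  define D :: "real \<Rightarrow> 'a \<Rightarrow> 'k" where "D \<epsilon> p = w \<epsilon> p * cj (w \<epsilon> p) + of_real (flat 0 \<epsilon>)" for \<epsilon> p
  have D: "D \<epsilon> p = of_real ((norm (w \<epsilon> p))\<^sup>2 + flat 0 \<epsilon>)" for \<epsilon> p
    by (simp add: D_def cj(2))
  have pos: "(norm (w \<epsilon> p))\<^sup>2 + flat 0 \<epsilon> > 0" if "\<epsilon> \<in> {0<..1}" for \<epsilon> p
    using flat_pos[of \<epsilon> 0] that by (simp add: add_nonneg_pos)
  have nz: "D \<epsilon> p \<noteq> 0" if "\<epsilon> \<in> {0<..1}" for \<epsilon> p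
    using pos[OF that, of p] unfolding D of_real_eq_0_iff by linarith
  have tempK: "tempered_on K (\<lambda>\<epsilon> p. inverse (D \<epsilon> p))" if K: "compact K" for K
  proof -
    obtain q where "\<forall>\<^sub>F \<epsilon> in at_right 0. \<forall>p\<in>K. \<epsilon> ^ q \<le> norm (w \<epsilon> p)"
      using inv K by (auto simp: bounded_below_net_def)
    then have "\<forall>\<^sub>F \<epsilon> in at_right 0. \<forall>p\<in>K. norm (inverse (D \<epsilon> p)) \<le> 1 / \<epsilon> ^ (q * 2)"
      using eventually_at_right_0_Ioc
    proof eventually_elim
      case (elim \<epsilon>)
      show ?case
      proof
        fix p assume p: "p \<in> K"
        have "\<epsilon> ^ (q * 2) \<le> (norm (w \<epsilon> p))\<^sup>2"
          unfolding power_mult using elim p by (intro power_mono) auto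
        also have "\<dots> \<le> norm (D \<epsilon> p)"
          using flat_nonneg[of 0 \<epsilon>] unfolding D norm_of_real by simp
        finally have "inverse (norm (D \<epsilon> p)) \<le> inverse (\<epsilon> ^ (q * 2))"
          using elim(2) by (intro le_imp_inverse_le) auto
        then show "norm (inverse (D \<epsilon> p)) \<le> 1 / \<epsilon> ^ (q * 2)"
          by (simp only: norm_inverse divide_inverse mult_1)
      qed
    qed
    then show ?thesis by (auto simp: tempered_on_def)
  qed
  have flat_bound: "norm (of_real (flat 0 \<epsilon>) :: 'k) \<le> 1" for \<epsilon>
    using flat_nonneg[of 0 \<epsilon>] flat_0_le_1[of \<epsilon>] by simp
  have local: "smooth_tempered (\<phi> ` U) (\<lambda>\<epsilon> x. inverse (D \<epsilon> (inv_into U \<phi> x)))"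
    "smooth_tempered (\<phi> ` U) (\<lambda>\<epsilon> x. cj (w \<epsilon> (inv_into U \<phi> x)))" if U: "(U, \<phi>) \<in> A" for U \<phi>
  proof -
    note op = chart(2)[OF U] and w' = moderate_imp_smooth_tempered[OF w U]
    show cw: "smooth_tempered (\<phi> ` U) (\<lambda>\<epsilon> x. cj (w \<epsilon> (inv_into U \<phi> x)))"
      by (rule smooth_tempered_bounded_linear[OF cj(1) op w'])
    have "smooth_tempered (\<phi> ` U) (\<lambda>\<epsilon> x. D \<epsilon> (inv_into U \<phi> x))"
      unfolding D_def
      by (intro smooth_tempered_add smooth_tempered_mult op w' cw smooth_tempered_const[of _ 1] flat_bound)
    then show "smooth_tempered (\<phi> ` U) (\<lambda>\<epsilon> x. inverse (D \<epsilon> (inv_into U \<phi> x)))"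
    proof (rule smooth_tempered_inverse[OF op])
      show "tempered_on C (\<lambda>\<epsilon> x. inverse (D \<epsilon> (inv_into U \<phi> x)))"
        if C: "compact C" "C \<subseteq> \<phi> ` U" for C
        by (rule tempered_on_comp[OF tempK[OF chart_preimage_compact[OF U C]]]) simp
    qed (rule nz)
  qed
  define v :: "('a, 'k) net" where "v = (\<lambda>\<epsilon>\<in>{0<..1}. \<lambda>p. cj (w \<epsilon> p) * inverse (D \<epsilon> p))"
  define n :: "('a, 'k) net" where
    "n = (\<lambda>\<epsilon>\<in>{0<..1}. \<lambda>p. (- inverse (D \<epsilon> p)) * of_real (flat 0 \<epsilon>))"
  show thesis
  proof (rule that[of v n])
    show "v \<in> moderate A"
      unfolding v_def by (intro moderateI smooth_tempered_mult local chart(2))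
    have "n \<in> moderate A"
      unfolding n_def
      by (intro moderateI smooth_tempered_mult smooth_tempered_const[of _ 1] flat_bound chart(2)
          smooth_tempered_bounded_linear[OF bounded_linear_minus[OF bounded_linear_ident]] local(1))
    moreover have "rapid_on K n" if "compact K" for K
    proof -
      have "tempered_on K (\<lambda>\<epsilon> p. - inverse (D \<epsilon> p))"
        by (rule tempered_on_mono[OF tempK[OF that]]) auto
      then show ?thesis
        unfolding n_def rapid_on_restrict by (intro tempered_rapid_mult rapid_on_flat)
    qed
    ultimately show "n \<in> negligible_nets A" by (simp add: negligible_nets_iff_rapid)
    show "w \<epsilon> p * v \<epsilon> p = n \<epsilon> p + 1" if "\<epsilon> \<in> {0<..1}" for \<epsilon> p
    proof -
      have "w \<epsilon> p * cj (w \<epsilon> p) = D \<epsilon> p - of_real (flat 0 \<epsilon>)" by (simp add: D_def)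
      then have "w \<epsilon> p * v \<epsilon> p = (D \<epsilon> p - of_real (flat 0 \<epsilon>)) * inverse (D \<epsilon> p)"
        using that by (simp add: v_def mult.assoc[symmetric])
      also have "\<dots> = n \<epsilon> p + 1"
        using that nz[OF that, of p] by (simp add: n_def left_diff_distrib)
      finally show ?thesis .
    qed
  qed
qed

text \<open>Both directions transport the statement along \<open>u = N + w\<close>: equality of cosets means that the
  representatives differ by a negligible net. Every member of \<open>u\<close> is such a representative.\<close>

lemma colombeau_invertible_iff:
  fixes u :: "('a, 'k::real_normed_field) net set"
  assumes cj: "bounded_linear cj" "\<And>z :: 'k. z * cj z = of_real ((norm z)\<^sup>2)"
    and u: "u \<in> carrier (colombeau A)"
  shows "(\<exists>v\<in>carrier (colombeau A). u \<otimes>\<^bsub>colombeau A\<^esub> v = \<one>\<^bsub>colombeau A\<^esub>) \<longleftrightarrow>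
    (\<forall>w\<in>u. bounded_below_net w)"
proof -
  let ?R = "moderate_ring A :: ('a, 'k) net ring" and ?N = "negligible_nets A :: ('a, 'k) net set"
  interpret ideal ?N ?R by (rule negligible_ideal)
  have carrier: "carrier (colombeau A) = (\<lambda>w. ?N +>\<^bsub>?R\<^esub> w) ` moderate A"
    by (auto simp: colombeau_def FactRing_def A_RCOSETS_def' moderate_ring_simps)
  have prod: "(?N +>\<^bsub>?R\<^esub> w) \<otimes>\<^bsub>colombeau A\<^esub> (?N +>\<^bsub>?R\<^esub> z) = ?N +>\<^bsub>?R\<^esub> (w \<otimes>\<^bsub>?R\<^esub> z)"
    if "w \<in> moderate A" "z \<in> moderate A" for w z
    using rcoset_mult_add[of w z] that by (simp add: colombeau_def FactRing_def moderate_ring_simps(1))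
  have one: "\<one>\<^bsub>colombeau A\<^esub> = ?N +>\<^bsub>?R\<^esub> \<one>\<^bsub>?R\<^esub>" by (simp add: colombeau_def FactRing_def)
  obtain w0 where w0: "w0 \<in> moderate A" "u = ?N +>\<^bsub>?R\<^esub> w0" using u carrier by auto
  have repr: "w \<in> moderate A \<and> u = ?N +>\<^bsub>?R\<^esub> w" if "w \<in> u" for w
    using that w0 a_elemrcos_carrier[of w0 w] a_repr_independence[OF _ _ a_subgroup, of w w0]
    by (simp add: moderate_ring_simps(1))
  show ?thesis
  proof (intro iffI ballI)
    fix w assume "\<exists>v\<in>carrier (colombeau A). u \<otimes>\<^bsub>colombeau A\<^esub> v = \<one>\<^bsub>colombeau A\<^esub>" and "w \<in> u"
    then obtain z where z: "z \<in> moderate A"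
      and uz: "u \<otimes>\<^bsub>colombeau A\<^esub> (?N +>\<^bsub>?R\<^esub> z) = \<one>\<^bsub>colombeau A\<^esub>"
      unfolding carrier by blast
    have w: "w \<in> moderate A" "u = ?N +>\<^bsub>?R\<^esub> w" using repr[OF \<open>w \<in> u\<close>] by auto
    have "?N +>\<^bsub>?R\<^esub> (w \<otimes>\<^bsub>?R\<^esub> z) = ?N +>\<^bsub>?R\<^esub> \<one>\<^bsub>?R\<^esub>"
      using uz prod[OF w(1) z] unfolding w(2)[symmetric] one by simp
    then have "w \<otimes>\<^bsub>?R\<^esub> z \<in> ?N +>\<^bsub>?R\<^esub> \<one>\<^bsub>?R\<^esub>"
      using a_rcos_self[of "w \<otimes>\<^bsub>?R\<^esub> z"] m_closed[of w z] w(1) z by (simp add: moderate_ring_simps(1))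
    then obtain n where n: "n \<in> ?N" "w \<otimes>\<^bsub>?R\<^esub> z = n \<oplus>\<^bsub>?R\<^esub> \<one>\<^bsub>?R\<^esub>"
      unfolding a_r_coset_def' by blast
    have "w \<epsilon> p * z \<epsilon> p = n \<epsilon> p + 1" if "\<epsilon> \<in> {0<..1}" for \<epsilon> p
      using fun_cong[OF fun_cong[OF n(2), of \<epsilon>], of p] that by (simp add: moderate_ring_simps)
    then show "bounded_below_net w" by (rule unit_imp_bounded_below_net[OF z n(1)])
  next
    assume *: "\<forall>w\<in>u. bounded_below_net w"
    have "w0 \<in> u" using w0 a_rcos_self[of w0] by (simp add: moderate_ring_simps(1))
    then have "bounded_below_net w0" using * by blast
    then obtain v n where vn: "v \<in> moderate A" "n \<in> ?N"
      "\<And>\<epsilon> p. \<epsilon> \<in> {0<..1} \<Longrightarrow> w0 \<epsilon> p * v \<epsilon> p = n \<epsilon> p + 1"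
      using bounded_below_net_imp_unit[OF cj w0(1)] by metis
    have "w0 \<otimes>\<^bsub>?R\<^esub> v = n \<oplus>\<^bsub>?R\<^esub> \<one>\<^bsub>?R\<^esub>"
      unfolding moderate_ring_simps using vn(3) by (intro restrict_ext) auto
    then have "w0 \<otimes>\<^bsub>?R\<^esub> v \<in> ?N +>\<^bsub>?R\<^esub> \<one>\<^bsub>?R\<^esub>" using vn(2) unfolding a_r_coset_def' by blast
    then have "?N +>\<^bsub>?R\<^esub> (w0 \<otimes>\<^bsub>?R\<^esub> v) = ?N +>\<^bsub>?R\<^esub> \<one>\<^bsub>?R\<^esub>"
      using a_repr_independence[OF _ one_closed a_subgroup] by simp
    then have "u \<otimes>\<^bsub>colombeau A\<^esub> (?N +>\<^bsub>?R\<^esub> v) = \<one>\<^bsub>colombeau A\<^esub>"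
      using w0 vn(1) prod one by simp
    then show "\<exists>v\<in>carrier (colombeau A). u \<otimes>\<^bsub>colombeau A\<^esub> v = \<one>\<^bsub>colombeau A\<^esub>"
      using vn(1) carrier by blast
  qed
qed

end

theorem proposition2p1:
  fixes A :: "('a::t2_space, 'e::real_inner) chart set"
  assumes "smooth_atlas A"
    and "paracompact_space (euclidean :: 'a topology)"
  shows
    "(\<forall>u :: ('a, real) net set. u \<in> carrier (colombeau A) \<longrightarrow>
        ((\<exists>v\<in>carrier (colombeau A). u \<otimes>\<^bsub>colombeau A\<^esub> v = \<one>\<^bsub>colombeau A\<^esub>)
         \<longleftrightarrow>
         (\<forall>w\<in>u. \<forall>K. compact K \<longrightarrow>
            (\<exists>\<epsilon>\<^sub>0>0. \<exists>q::nat. \<forall>\<epsilon>\<in>{0<..1}. \<epsilon> < \<epsilon>\<^sub>0 \<longrightarrow>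
               (INF p\<in>K. ereal (norm (w \<epsilon> p))) \<ge> ereal (\<epsilon> ^ q)))))
     \<and>
     (\<forall>u :: ('a, complex) net set. u \<in> carrier (colombeau A) \<longrightarrow>
        ((\<exists>v\<in>carrier (colombeau A). u \<otimes>\<^bsub>colombeau A\<^esub> v = \<one>\<^bsub>colombeau A\<^esub>)
         \<longleftrightarrow>
         (\<forall>w\<in>u. \<forall>K. compact K \<longrightarrow>
            (\<exists>\<epsilon>\<^sub>0>0. \<exists>q::nat. \<forall>\<epsilon>\<in>{0<..1}. \<epsilon> < \<epsilon>\<^sub>0 \<longrightarrow>
               (INF p\<in>K. ereal (norm (w \<epsilon> p))) \<ge> ereal (\<epsilon> ^ q)))))"
proof -
  interpret smooth_manifold A by unfold_locales (rule assms(1))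
  have "z * z = of_real ((norm z)\<^sup>2)" for z :: real by (simp add: power2_eq_square)
  note real = colombeau_invertible_iff[OF bounded_linear_ident this]
  have "z * cnj z = of_real ((norm z)\<^sup>2)" for z :: complex by (rule complex_norm_square[symmetric])
  note complex = colombeau_invertible_iff[OF bounded_linear_cnj this]
  show ?thesis
    unfolding bounded_below_net_iff_INF[symmetric] using real complex by blast
qed

end
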